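(* Assume that the closed-loop system $$\dot{x}(t)=A_{0}x(t)+A_{1}x(t-h)+\int_{-h}^{0}G(\theta)x(t+\theta)\,d\theta,\qquad t\ge0,$$ is exponentially stable, with delay Lyapunov matrix function $U(\tau,M)=\int_0^\infty K^T(t)MK(t+\tau)\,dt$, where $K$ is its fundamental matrix. Let $M_1=Q+\Gamma_0^TR\Gamma_0$, $M_2(\theta)=\Gamma_0^TR\Gamma_1(\theta)$, $M_3(\theta_1,\theta_2)=\Gamma_1^T(\theta_1)R\Gamma_1(\theta_2)$. Then the matrix $\Pi_0$ and the matrix functions $\Pi_1(\theta)$, $\Pi_2(\xi,\theta)$, $\xi,\theta\in[-h,0]$, given by the following expressions exist and are unique: $$\Pi_0=U(0,M_1)+2\int_{-h}^0U(\theta,M_2(\theta))\,d\theta+\int_{-h}^0\int_{-h}^0U(-\theta_1+\theta_2,M_3(\theta_1,\theta_2))\,d\theta_1\,d\theta_2,$$ $$\begin{aligned}\Pi_1(\theta)=&\,U(-\theta-h,M_1)A_1+\int_{-h}^\theta U(-\theta+\delta,M_1)G(\delta)\,d\delta+\int_{-h}^0U(\theta_2-\theta-h,M_2(\theta_2))\,d\theta_2A_1\\&+\int_{-h}^0U(-\theta_2-\theta-h,M_2^T(\theta_2))\,d\theta_2A_1+\int_{-h}^0\int_{-h}^\theta U(\theta_2-\theta+\delta,M_2(\theta_2))G(\delta)\,d\delta\,d\theta_2\\&+\int_{-h}^0\int_{-h}^\theta U(-\theta_2-\theta+\delta,M_2^T(\theta_2))G(\delta)\,d\delta\,d\theta_2+\int_{-h}^0\int_{-h}^0U(-\theta_1+\theta_2-\theta-h,M_3(\theta_1,\theta_2))\,d\theta_1\,d\theta_2A_1\\&+\int_{-h}^0\int_{-h}^0\int_{-h}^\theta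 U(-\theta_1+\theta_2-\theta+\delta,M_3(\theta_1,\theta_2))G(\delta)\,d\delta\,d\theta_1\,d\theta_2,\end{aligned}$$ $$\begin{aligned}\Pi_2(\xi,\theta)=&\,A_1^TU(\xi-\theta,M_1)A_1+A_1^T\int_{-h}^\theta U(\xi+h-\theta+\delta,M_1)G(\delta)\,d\delta+\int_{-h}^\xi G^T(\delta)U(\xi-\delta-\theta-h,M_1)A_1\,d\delta\\&+\int_{-h}^\xi\int_{-h}^\theta G^T(\delta_1)U(\xi-\theta-\delta_1+\delta_2,M_1)G(\delta_2)\,d\delta_2\,d\delta_1+2A_1^T\int_{-h}^0U(\xi+\theta_2-\theta,M_2(\theta_2))\,d\theta_2A_1\\&+2A_1^T\int_{-h}^0\int_{-h}^\theta U(\xi+h+\theta_2-\theta+\delta,M_2(\theta_2))G(\delta)\,d\delta\,d\theta_2\\&+2\int_{-h}^0\int_{-h}^\xi G^T(\delta)U(\xi-\delta+\theta_2-\theta-h,M_2(\theta_2))\,d\delta\,d\theta_2A_1\\&+2\int_{-h}^0\int_{-h}^\xi\int_{-h}^\theta G^T(\delta_1)U(\xi-\delta_1+\theta_2-\theta+\delta_2,M_2(\theta_2))G(\delta_2)\,d\delta_2\,d\delta_1\,d\theta_2\\&+A_1^T\int_{-h}^0\int_{-h}^0U(-\theta_1+\xi+\theta_2-\theta,M_3(\theta_1,\theta_2))\,d\theta_1\,d\theta_2A_1\\&+A_1^T\int_{-h}^0\int_{-h}^0\int_{-h}^\theta U(-\theta_1+\xi+h+\theta_2-\theta+\delta,M_3(\theta_1,\theta_2))G(\delta)\,d\delta\,d\theta_1\,d\theta_2\\&+\int_{-h}^0\int_{-h}^0\int_{-h}^\xi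 G^T(\delta)U(-\theta_1+\xi-\delta+\theta_2-\theta-h,M_3(\theta_1,\theta_2))\,d\delta\,d\theta_1\,d\theta_2A_1\\&+\int_{-h}^0\int_{-h}^0\int_{-h}^\xi\int_{-h}^\theta G^T(\delta_1)U(-\theta_1+\xi-\delta_1+\theta_2-\theta+\delta_2,M_3(\theta_1,\theta_2))G(\delta_2)\,d\delta_2\,d\delta_1\,d\theta_1\,d\theta_2.\end{aligned}$$
   Context: The closed-loop system arises from $\dot x(t)=Ax(t)+Bx(t-h)+\int_{-h}^0E(\theta)x(t+\theta)\,d\theta+Du(t)$ with the linear control $u_L(x_t)=\Gamma_0x(t)+\int_{-h}^0\Gamma_1(\theta)x(t+\theta)\,d\theta$, so that $A_0=A+D\Gamma_0$, $A_1=B$, $G(\theta)=E(\theta)+D\Gamma_1(\theta)$. Here $h>0$; $A,B\in\mathbb{R}^{n\times n}$, $D\in\mathbb{R}^{n\times r}$ are constant; $E$ is a continuous $n\times n$ matrix function on $[-h,0]$; $\Gamma_0\in\mathbb{R}^{r\times n}$; $\Gamma_1$ is an $r\times n$ matrix function on $[-h,0]$ (such that the integrals involving it are defined); $Q\in\mathbb{R}^{n\times n}$ and $R\in\mathbb{R}^{r\times r}$ are symmetric positive definite. The fundamental matrix $K(t)$ satisfies $\dot K(t)=K(t)A_0+K(t-h)A_1+\int_{-h}^0K(t+\theta)G(\theta)\,d\theta$ for $t\ge0$, with $K(0)=I$ and $K(t)=0$ for $t<0$. For a constant matrix $M\in\mathbb{R}^{n\times n}$, $U(\tau,M)$ is defined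 for all $\tau\in\mathbb{R}$ by the integral given in the claim. *)

theory Defs
  imports "HOL-Analysis.Analysis"
begin

definition sym_pos_def :: "real^'n^'n \<Rightarrow> bool" where
  "sym_pos_def M \<longleftrightarrow> transpose M = M \<and> (\<forall>x. x \<noteq> 0 \<longrightarrow> x \<bullet> (M *v x) > 0)"

(* All integrals are Lebesgue integrals.  For continuous x and integrable G the integrand below
   is integrable, so the default value of a non-existing integral plays no role.  The derivative
   at t = 0 is the right-hand one. *)
definition solution ::
  "real \<Rightarrow> real^'n^'n \<Rightarrow> real^'n^'n \<Rightarrow> (real \<Rightarrow> real^'n^'n) \<Rightarrow> (real \<Rightarrow> real^'n) \<Rightarrow> (real \<Rightarrow> real^'n) \<Rightarrow> bool" where
  "solution h A0 A1 G \<phi> x \<longleftrightarrow>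
     (\<forall>\<theta>\<in>{-h..0}. x \<theta> = \<phi> \<theta>) \<and> continuous_on {-h..} x \<and>
     (\<forall>t\<ge>0. (x has_vector_derivative
        (A0 *v x t + A1 *v x (t - h) + (LINT \<theta>|lebesgue_on {-h..0}. G \<theta> *v x (t + \<theta>))))
        (at t within {0..}))"

definition exponentially_stable ::
  "real \<Rightarrow> real^'n^'n \<Rightarrow> real^'n^'n \<Rightarrow> (real \<Rightarrow> real^'n^'n) \<Rightarrow> bool" where
  "exponentially_stable h A0 A1 G \<longleftrightarrow>
     (\<exists>\<gamma>\<ge>1. \<exists>\<sigma>>0. \<forall>\<phi> x. continuous_on {-h..0} \<phi> \<longrightarrow> solution h A0 A1 G \<phi> x \<longrightarrow>
        (\<forall>t\<ge>0. norm (x t) \<le> \<gamma> * exp (- \<sigma> * t) * (SUP \<theta>\<in>{-h..0}. norm (\<phi> \<theta>))))"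

definition fundamental_rhs ::
  "real \<Rightarrow> real^'n^'n \<Rightarrow> real^'n^'n \<Rightarrow> (real \<Rightarrow> real^'n^'n) \<Rightarrow> (real \<Rightarrow> real^'n^'n) \<Rightarrow> real \<Rightarrow> real^'n^'n" where
  "fundamental_rhs h A0 A1 G K t =
     K t ** A0 + K (t - h) ** A1 + (LINT \<theta>|lebesgue_on {-h..0}. K (t + \<theta>) ** G \<theta>)"

(* K(t - h) jumps from 0 to I at t = h, so K is in general not differentiable there.  The equation
   is required for every t \<ge> 0, with the right-hand derivative at t = 0 and t = h and the
   two-sided derivative at all other t. *)
definition fundamental_matrix ::
  "real \<Rightarrow> real^'n^'n \<Rightarrow> real^'n^'n \<Rightarrow> (real \<Rightarrow> real^'n^'n) \<Rightarrow> (real \<Rightarrow> real^'n^'n) \<Rightarrow> bool" where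
  "fundamental_matrix h A0 A1 G K \<longleftrightarrow>
     (\<forall>t<0. K t = 0) \<and> K 0 = mat 1 \<and> continuous_on {0..} K \<and>
     (\<forall>t\<in>{0..<h}. (K has_vector_derivative fundamental_rhs h A0 A1 G K t) (at t within {0..<h})) \<and>
     (\<forall>t\<in>{h..}. (K has_vector_derivative fundamental_rhs h A0 A1 G K t) (at t within {h..}))"

definition delay_lyapunov_matrix ::
  "(real \<Rightarrow> real^'n^'n) \<Rightarrow> (real \<Rightarrow> real^'n^'n \<Rightarrow> real^'n^'n) \<Rightarrow> bool" where
  "delay_lyapunov_matrix K U \<longleftrightarrow>
     (\<forall>\<tau> M. has_bochner_integral (lebesgue_on {0..})
        (\<lambda>t. transpose (K t) ** M ** K (t + \<tau>)) (U \<tau> M))"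

(* Iterated integrals, the outermost variable first: has_iint2 S T f I says that the integral of
   f x y over y in T exists for every x in S, and that integrating the result over x in S
   gives I. *)
definition has_iint1 :: "real set \<Rightarrow> (real \<Rightarrow> 'a::{banach, second_countable_topology}) \<Rightarrow> 'a \<Rightarrow> bool" where
  "has_iint1 S f I \<longleftrightarrow> has_bochner_integral (lebesgue_on S) f I"

definition has_iint2 ::
  "real set \<Rightarrow> real set \<Rightarrow> (real \<Rightarrow> real \<Rightarrow> 'a::{banach, second_countable_topology}) \<Rightarrow> 'a \<Rightarrow> bool" where
  "has_iint2 S T f I \<longleftrightarrow> (\<exists>g. (\<forall>x\<in>S. has_iint1 T (f x) (g x)) \<and> has_iint1 S g I)"

definition has_iint3 ::
  "real set \<Rightarrow> real set \<Rightarrow> real set \<Rightarrow>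
   (real \<Rightarrow> real \<Rightarrow> real \<Rightarrow> 'a::{banach, second_countable_topology}) \<Rightarrow> 'a \<Rightarrow> bool" where
  "has_iint3 S T V f I \<longleftrightarrow> (\<exists>g. (\<forall>x\<in>S. has_iint2 T V (f x) (g x)) \<and> has_iint1 S g I)"

definition has_iint4 ::
  "real set \<Rightarrow> real set \<Rightarrow> real set \<Rightarrow> real set \<Rightarrow>
   (real \<Rightarrow> real \<Rightarrow> real \<Rightarrow> real \<Rightarrow> 'a::{banach, second_countable_topology}) \<Rightarrow> 'a \<Rightarrow> bool" where
  "has_iint4 S T V W f I \<longleftrightarrow> (\<exists>g. (\<forall>x\<in>S. has_iint3 T V W (f x) (g x)) \<and> has_iint1 S g I)"

definition has_Pi0 ::
  "real \<Rightarrow> (real \<Rightarrow> real^'n^'n \<Rightarrow> real^'n^'n) \<Rightarrow> real^'n^'n \<Rightarrow> (real \<Rightarrow> real^'n^'n) \<Rightarrow>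
   (real \<Rightarrow> real \<Rightarrow> real^'n^'n) \<Rightarrow> real^'n^'n \<Rightarrow> bool" where
  "has_Pi0 h U M1 M2 M3 P \<longleftrightarrow>
     (\<exists>I1 I2.
        has_iint1 {-h..0} (\<lambda>\<theta>. U \<theta> (M2 \<theta>)) I1 \<and>
        has_iint2 {-h..0} {-h..0} (\<lambda>\<theta>2 \<theta>1. U (- \<theta>1 + \<theta>2) (M3 \<theta>1 \<theta>2)) I2 \<and>
        P = U 0 M1 + 2 *\<^sub>R I1 + I2)"

definition has_Pi1 ::
  "real \<Rightarrow> real^'n^'n \<Rightarrow> (real \<Rightarrow> real^'n^'n) \<Rightarrow>
   (real \<Rightarrow> real^'n^'n \<Rightarrow> real^'n^'n) \<Rightarrow> real^'n^'n \<Rightarrow> (real \<Rightarrow> real^'n^'n) \<Rightarrow>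
   (real \<Rightarrow> real \<Rightarrow> real^'n^'n) \<Rightarrow> real \<Rightarrow> real^'n^'n \<Rightarrow> bool" where
  "has_Pi1 h A1 G U M1 M2 M3 \<theta> P \<longleftrightarrow>
     (\<exists>I1 I2 I3 I4 I5 I6 I7.
        has_iint1 {-h..\<theta>} (\<lambda>\<delta>. U (- \<theta> + \<delta>) M1 ** G \<delta>) I1 \<and>
        has_iint1 {-h..0} (\<lambda>\<theta>2. U (\<theta>2 - \<theta> - h) (M2 \<theta>2)) I2 \<and>
        has_iint1 {-h..0} (\<lambda>\<theta>2. U (- \<theta>2 - \<theta> - h) (transpose (M2 \<theta>2))) I3 \<and>
        has_iint2 {-h..0} {-h..\<theta>} (\<lambda>\<theta>2 \<delta>. U (\<theta>2 - \<theta> + \<delta>) (M2 \<theta>2) ** G \<delta>) I4 \<and>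
        has_iint2 {-h..0} {-h..\<theta>} (\<lambda>\<theta>2 \<delta>. U (- \<theta>2 - \<theta> + \<delta>) (transpose (M2 \<theta>2)) ** G \<delta>) I5 \<and>
        has_iint2 {-h..0} {-h..0} (\<lambda>\<theta>2 \<theta>1. U (- \<theta>1 + \<theta>2 - \<theta> - h) (M3 \<theta>1 \<theta>2)) I6 \<and>
        has_iint3 {-h..0} {-h..0} {-h..\<theta>}
          (\<lambda>\<theta>2 \<theta>1 \<delta>. U (- \<theta>1 + \<theta>2 - \<theta> + \<delta>) (M3 \<theta>1 \<theta>2) ** G \<delta>) I7 \<and>
        P = U (- \<theta> - h) M1 ** A1 + I1 + I2 ** A1 + I3 ** A1 + I4 + I5 + I6 ** A1 + I7)"

definition has_Pi2 ::
  "real \<Rightarrow> real^'n^'n \<Rightarrow> (real \<Rightarrow> real^'n^'n) \<Rightarrow>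
   (real \<Rightarrow> real^'n^'n \<Rightarrow> real^'n^'n) \<Rightarrow> real^'n^'n \<Rightarrow> (real \<Rightarrow> real^'n^'n) \<Rightarrow>
   (real \<Rightarrow> real \<Rightarrow> real^'n^'n) \<Rightarrow> real \<Rightarrow> real \<Rightarrow> real^'n^'n \<Rightarrow> bool" where
  "has_Pi2 h A1 G U M1 M2 M3 \<xi> \<theta> P \<longleftrightarrow>
     (\<exists>I1 I2 I3 I4 I5 I6 I7 I8 I9 I10 I11.
        has_iint1 {-h..\<theta>} (\<lambda>\<delta>. U (\<xi> + h - \<theta> + \<delta>) M1 ** G \<delta>) I1 \<and>
        has_iint1 {-h..\<xi>} (\<lambda>\<delta>. transpose (G \<delta>) ** U (\<xi> - \<delta> - \<theta> - h) M1 ** A1) I2 \<and>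
        has_iint2 {-h..\<xi>} {-h..\<theta>}
          (\<lambda>\<delta>1 \<delta>2. transpose (G \<delta>1) ** U (\<xi> - \<theta> - \<delta>1 + \<delta>2) M1 ** G \<delta>2) I3 \<and>
        has_iint1 {-h..0} (\<lambda>\<theta>2. U (\<xi> + \<theta>2 - \<theta>) (M2 \<theta>2)) I4 \<and>
        has_iint2 {-h..0} {-h..\<theta>}
          (\<lambda>\<theta>2 \<delta>. U (\<xi> + h + \<theta>2 - \<theta> + \<delta>) (M2 \<theta>2) ** G \<delta>) I5 \<and>
        has_iint2 {-h..0} {-h..\<xi>}
          (\<lambda>\<theta>2 \<delta>. transpose (G \<delta>) ** U (\<xi> - \<delta> + \<theta>2 - \<theta> - h) (M2 \<theta>2)) I6 \<and>
        has_iint3 {-h..0} {-h..\<xi>} {-h..\<theta>}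
          (\<lambda>\<theta>2 \<delta>1 \<delta>2. transpose (G \<delta>1) ** U (\<xi> - \<delta>1 + \<theta>2 - \<theta> + \<delta>2) (M2 \<theta>2) ** G \<delta>2) I7 \<and>
        has_iint2 {-h..0} {-h..0}
          (\<lambda>\<theta>2 \<theta>1. U (- \<theta>1 + \<xi> + \<theta>2 - \<theta>) (M3 \<theta>1 \<theta>2)) I8 \<and>
        has_iint3 {-h..0} {-h..0} {-h..\<theta>}
          (\<lambda>\<theta>2 \<theta>1 \<delta>. U (- \<theta>1 + \<xi> + h + \<theta>2 - \<theta> + \<delta>) (M3 \<theta>1 \<theta>2) ** G \<delta>) I9 \<and>
        has_iint3 {-h..0} {-h..0} {-h..\<xi>}
          (\<lambda>\<theta>2 \<theta>1 \<delta>. transpose (G \<delta>) ** U (- \<theta>1 + \<xi> - \<delta> + \<theta>2 - \<theta> - h) (M3 \<theta>1 \<theta>2)) I10 \<and>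
        has_iint4 {-h..0} {-h..0} {-h..\<xi>} {-h..\<theta>}
          (\<lambda>\<theta>2 \<theta>1 \<delta>1 \<delta>2. transpose (G \<delta>1)
             ** U (- \<theta>1 + \<xi> - \<delta>1 + \<theta>2 - \<theta> + \<delta>2) (M3 \<theta>1 \<theta>2) ** G \<delta>2) I11 \<and>
        P = transpose A1 ** U (\<xi> - \<theta>) M1 ** A1 + transpose A1 ** I1 + I2 + I3
            + 2 *\<^sub>R (transpose A1 ** I4 ** A1) + 2 *\<^sub>R (transpose A1 ** I5)
            + 2 *\<^sub>R (I6 ** A1) + 2 *\<^sub>R I7
            + transpose A1 ** I8 ** A1 + transpose A1 ** I9 + I10 ** A1 + I11)"

(* Only the values of P1 on [-h,0] and of P2 on [-h,0] x [-h,0] are constrained. *)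
definition Pi_system ::
  "real \<Rightarrow> real^'n^'n \<Rightarrow> real^'n^'n \<Rightarrow> (real \<Rightarrow> real^'n^'n) \<Rightarrow>
   real^'n^'n \<Rightarrow> (real \<Rightarrow> real^'n^'n) \<Rightarrow> (real \<Rightarrow> real \<Rightarrow> real^'n^'n) \<Rightarrow>
   real^'n^'n \<Rightarrow> (real \<Rightarrow> real^'n^'n) \<Rightarrow> (real \<Rightarrow> real \<Rightarrow> real^'n^'n) \<Rightarrow> bool" where
  "Pi_system h A0 A1 G M1 M2 M3 P0 P1 P2 \<longleftrightarrow>
     (\<exists>K U. fundamental_matrix h A0 A1 G K \<and> delay_lyapunov_matrix K U \<and>
        has_Pi0 h U M1 M2 M3 P0 \<and>
        (\<forall>\<theta>\<in>{-h..0}. has_Pi1 h A1 G U M1 M2 M3 \<theta> (P1 \<theta>)) \<and>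
        (\<forall>\<xi>\<in>{-h..0}. \<forall>\<theta>\<in>{-h..0}. has_Pi2 h A1 G U M1 M2 M3 \<xi> \<theta> (P2 \<xi> \<theta>)))"

end

theory Submission
  imports Defs
begin

text \<open>
  All matrices in the claim are determined by the fundamental matrix K. Uniqueness therefore reduces to
  uniqueness of K, and existence to that of K, of the improper integral U, and of the iterated integrals.

  Let * denote convolution and let H be the identity matrix times the Heaviside function. Integrating
  the delay equation once turns it into the Volterra equation K = H + K * N, where
  N = A0 H(t) + A1 H(t - h) + \<integral> G is bounded although G is merely integrable
  (\<open>fundamental_matrix_imp_volterra\<close>, \<open>volterra_imp_fundamental_matrix\<close>). A contraction in an exponentially
  weighted norm solves it (\<open>volterra_exists\<close>).

  The coefficients multiply K from the right, while exponential stability concerns the system in which they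
  multiply the state from the left. The bridge is \<open>resolvent_left_eq_right\<close>: because H is central,
  associativity of convolution forces every solution of K = H + K * N to coincide with every solution of
  L = H + N * L. As L exists by transposition, K is unique, and K satisfies both equations. Hence the columns of
  K, started at time h where their history is continuous, are solutions of the stable system, and K
  decays exponentially (\<open>fundamental_matrix_decay\<close>).

  By this decay U(\<tau>, M) exists; it is bounded, linear in M and continuous in \<tau>, the last because the
  jump of K at 0 affects a null set only. Maps of this type are closed under integration against integrable
  weights (\<open>kernel_operator_integral\<close>), so the iterated integrals of U against G and \<Gamma>1 are constructed from the
  innermost one outwards.
\<close>

section \<open>Matrix products and integrals depending on a parameter\<close>

lemma bounded_bilinear_matrix_mult:
  "bounded_bilinear ((**) :: real^'n^'m \<Rightarrow> real^'p^'n \<Rightarrow> real^'p^'m)"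
  unfolding bilinear_conv_bounded_bilinear [symmetric] bilinear_def
  by (auto intro!: linearI simp: matrix_matrix_mult_def vec_eq_iff sum.distrib
      sum_distrib_left algebra_simps)

lemma bounded_linear_transpose: "bounded_linear (transpose :: real^'n^'m \<Rightarrow> real^'m^'n)"
  unfolding linear_conv_bounded_linear [symmetric]
  by (auto intro!: linearI simp: transpose_def vec_eq_iff)

interpretation mm: bounded_bilinear "(**) :: real^'n^'m \<Rightarrow> real^'p^'n \<Rightarrow> real^'p^'m"
  by (rule bounded_bilinear_matrix_mult)

lemma transpose_0: "transpose (0 :: real^'n^'m) = 0"
  by (simp add: transpose_def vec_eq_iff)

lemma transpose_scaleR: "transpose (c *\<^sub>R X) = c *\<^sub>R transpose (X :: real^'n^'m)"
  by (simp add: transpose_def vec_eq_iff)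

lemma borel_measurable_matrix_mult [measurable (raw)]:
  fixes f :: "'x \<Rightarrow> real^'n^'m" and g :: "'x \<Rightarrow> real^'p^'n"
  assumes "f \<in> borel_measurable M" "g \<in> borel_measurable M"
  shows "(\<lambda>x. f x ** g x) \<in> borel_measurable M"
  using assms by (rule borel_measurable_continuous_Pair) (intro continuous_intros mm.continuous_on)

lemma borel_measurable_transpose [measurable (raw)]:
  fixes f :: "'x \<Rightarrow> real^'n^'m"
  assumes "f \<in> borel_measurable M"
  shows "(\<lambda>x. transpose (f x)) \<in> borel_measurable M"
proof -
  have "transpose \<in> borel_measurable (borel :: (real^'n^'m) measure)"
    by (intro borel_measurable_continuous_onI bounded_linear.continuous_on[OF bounded_linear_transpose] continuous_intros)
  then show ?thesis using assms by measurable
qed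

lemma matrix_mult_bound:
  obtains C where "C > 0"
    "\<And>(X :: real^'n^'m) (Y :: real^'p^'n). norm (X ** Y) \<le> C * (norm X * norm Y)"
proof -
  obtain C where "C > 0" "\<And>(X :: real^'n^'m) (Y :: real^'p^'n). norm (X ** Y) \<le> norm X * norm Y * C"
    using mm.pos_bounded by blast
  then show ?thesis using that[of C] by (simp add: algebra_simps)
qed

text \<open>Continuity is assumed for almost every s only, because the functions K(t - s) that occur below jump
  at the single point s = t.\<close>

lemma isCont_integral_dominated:
  fixes \<Phi> :: "real \<Rightarrow> 'a \<Rightarrow> 'b::{banach, second_countable_topology}"
  assumes meas: "\<And>t. \<Phi> t \<in> borel_measurable M" and w: "integrable M w"
    and bound: "\<And>t. AE s in M. norm (\<Phi> t s) \<le> w s"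
    and cont: "AE s in M. isCont (\<lambda>t. \<Phi> t s) t"
  shows "isCont (\<lambda>t. \<integral>s. \<Phi> t s \<partial>M) t"
proof (rule continuous_at_sequentiallyI)
  fix u :: "nat \<Rightarrow> real" assume u: "u \<longlonglongrightarrow> t"
  show "(\<lambda>n. \<integral>s. \<Phi> (u n) s \<partial>M) \<longlonglongrightarrow> (\<integral>s. \<Phi> t s \<partial>M)"
  proof (rule integral_dominated_convergence[where w = w])
    show "AE s in M. (\<lambda>n. \<Phi> (u n) s) \<longlonglongrightarrow> \<Phi> t s"
      using cont by eventually_elim (rule isCont_tendsto_compose[OF _ u])
  qed (use meas w bound in auto)
qed

section \<open>Convolution of causal matrix functions\<close>

text \<open>The bound, and below it the integrability, refers to each half line {..T} separately: the fundamental matrix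
  is known to be globally bounded only after it has been constructed and its decay has been
  derived from stability.\<close>

definition causal_bounded :: "(real \<Rightarrow> 'a::real_normed_vector) \<Rightarrow> bool" where
  "causal_bounded f \<longleftrightarrow> f \<in> borel_measurable borel \<and> (\<forall>t<0. f t = 0) \<and>
     (\<forall>T. \<exists>B. \<forall>t\<le>T. norm (f t) \<le> B)"

definition causal_integrable ::
    "(real \<Rightarrow> 'a::{banach, second_countable_topology}) \<Rightarrow> bool" where
  "causal_integrable g \<longleftrightarrow> g \<in> borel_measurable borel \<and> (\<forall>t<0. g t = 0) \<and>
     (\<forall>T. integrable lborel (\<lambda>t. indicator {..T} t *\<^sub>R g t))"

lemma causal_boundedD:
  assumes "causal_bounded f"
  shows "f \<in> borel_measurable borel" "\<And>t. t < 0 \<Longrightarrow> f t = 0"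
  using assms by (auto simp: causal_bounded_def)

lemma causal_bounded_bound:
  assumes "causal_bounded f"
  obtains B where "B \<ge> 0" "\<And>t. t \<le> T \<Longrightarrow> norm (f t) \<le> B"
proof -
  obtain B where "\<And>t. t \<le> T \<Longrightarrow> norm (f t) \<le> B"
    using assms unfolding causal_bounded_def by metis
  then show ?thesis by (intro that[of "max B 0"]) (auto simp: le_max_iff_disj)
qed

lemma causal_integrableD:
  assumes "causal_integrable f"
  shows "f \<in> borel_measurable borel" "\<And>t. t < 0 \<Longrightarrow> f t = 0"
    "integrable lborel (\<lambda>t. indicator {..T} t *\<^sub>R f t)"
  using assms by (auto simp: causal_integrable_def)

lemma causal_bounded_imp_integrable:
  assumes "causal_bounded f"
  shows "causal_integrable f"
  unfolding causal_integrable_def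
proof (intro conjI allI impI)
  note [measurable] = causal_boundedD(1)[OF assms]
  show "f \<in> borel_measurable borel" by measurable
  show "f t = 0" if "t < 0" for t using causal_boundedD(2)[OF assms that] .
  fix T
  obtain B where B: "B \<ge> 0" "\<And>t. t \<le> T \<Longrightarrow> norm (f t) \<le> B"
    using causal_bounded_bound[OF assms] by blast
  show "integrable lborel (\<lambda>t. indicator {..T} t *\<^sub>R f t)"
  proof (rule Bochner_Integration.integrable_bound)
    show "integrable lborel (\<lambda>t. B * indicator {0..T} t :: real)"
      by (cases "T \<ge> 0") auto
    show "AE t in lborel. norm (indicator {..T} t *\<^sub>R f t) \<le> norm (B * indicator {0..T} t :: real)"
      using B causal_boundedD(2)[OF assms] by (intro AE_I2) (auto simp: indicator_def not_le)
  qed measurable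
qed

text \<open>For causal functions this is the integral over [0, t]. Integrating over the whole line with respect to
  the Borel measure lets Fubini's theorem and affine substitutions apply without boundary terms.\<close>

definition conv :: "(real \<Rightarrow> real^'n^'n) \<Rightarrow> (real \<Rightarrow> real^'n^'n) \<Rightarrow> real \<Rightarrow> real^'n^'n" where
  "conv f g t = (\<integral>s. f (t - s) ** g s \<partial>lborel)"

lemma conv_commuted: "conv f g t = (\<integral>s. f s ** g (t - s) \<partial>lborel)"
  unfolding conv_def
  by (subst lborel_integral_real_affine[where c = "-1" and t = t]) auto

text \<open>Transposition reverses products. This turns the equation with the kernel on the left of the unknown
  into one with the kernel on the right.\<close>

lemma conv_transpose:
  "conv (\<lambda>t. transpose (f t)) (\<lambda>t. transpose (g t)) t = transpose (conv g f t)"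
proof -
  have "transpose (\<integral>s. g s ** f (t - s) \<partial>lborel) = (\<integral>s. transpose (g s ** f (t - s)) \<partial>lborel)"
  proof (cases "integrable lborel (\<lambda>s. g s ** f (t - s))")
    case True then show ?thesis by (rule integral_bounded_linear[OF bounded_linear_transpose, symmetric])
  next
    case False
    moreover have "\<not> integrable lborel (\<lambda>s. transpose (g s ** f (t - s)))"
      using False integrable_bounded_linear[OF bounded_linear_transpose, of lborel "\<lambda>s. transpose (g s ** f (t - s))"]
      by auto
    ultimately show ?thesis by (simp add: not_integrable_integral_eq transpose_0)
  qed
  then show ?thesis
    by (simp add: conv_commuted[of g f] conv_def[of "\<lambda>t. transpose (f t)"] matrix_transpose_mul)
qed

lemma conv_integrable:
  fixes f g :: "real \<Rightarrow> real^'n^'n"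
  assumes f: "causal_bounded f" and g: "causal_integrable g"
  shows "integrable lborel (\<lambda>s. f (t - s) ** g s)"
proof -
  note [measurable] = causal_boundedD(1)[OF f] causal_integrableD(1)[OF g]
  obtain C where C: "C > 0" "\<And>(X :: real^'n^'n) (Y :: real^'n^'n). norm (X ** Y) \<le> C * (norm X * norm Y)"
    using matrix_mult_bound by metis
  obtain B where B: "B \<ge> 0" "\<And>s. s \<le> t \<Longrightarrow> norm (f s) \<le> B"
    using causal_bounded_bound[OF f] by blast
  show ?thesis
  proof (rule Bochner_Integration.integrable_bound)
    show "integrable lborel (\<lambda>s. (C * B) *\<^sub>R (indicator {..t} s *\<^sub>R g s))"
      using causal_integrableD(3)[OF g] by (intro integrable_scaleR_right)
    show "AE s in lborel. norm (f (t - s) ** g s) \<le> norm ((C * B) *\<^sub>R (indicator {..t} s *\<^sub>R g s))"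
    proof (intro AE_I2)
      fix s
      show "norm (f (t - s) ** g s) \<le> norm ((C * B) *\<^sub>R (indicator {..t} s *\<^sub>R g s))"
      proof (cases "s < 0 \<or> s > t")
        case True
        then have "f (t - s) ** g s = 0"
          using causal_boundedD(2)[OF f, of "t - s"] causal_integrableD(2)[OF g, of s]
          by (auto simp: mm.zero_left mm.zero_right)
        then show ?thesis by simp
      next
        case False
        have "norm (f (t - s) ** g s) \<le> C * (norm (f (t - s)) * norm (g s))" by (rule C)
        also have "\<dots> \<le> C * (B * norm (g s))"
          using False C B by (intro mult_left_mono mult_right_mono) auto
        finally show ?thesis using False B C by (auto simp: mult_ac)
      qed
    qed
  qed measurable
qed

lemma causal_transpose:
  fixes f g :: "real \<Rightarrow> real^'n^'m"
  shows
  "causal_bounded f \<Longrightarrow> causal_bounded (\<lambda>t. transpose (f t :: real^'n^'m))"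
  "causal_integrable g \<Longrightarrow> causal_integrable (\<lambda>t. transpose (g t :: real^'n^'m))"
proof -
  assume f: "causal_bounded f"
  note [measurable] = causal_boundedD(1)[OF f]
  obtain C where C: "C \<ge> 0" "\<And>X :: real^'n^'m. norm (transpose X) \<le> norm X * C"
    using bounded_linear.nonneg_bounded[OF bounded_linear_transpose] by blast
  have "\<exists>B. \<forall>t\<le>T. norm (transpose (f t)) \<le> B" for T
  proof -
    obtain B where B: "B \<ge> 0" "\<And>s. s \<le> T \<Longrightarrow> norm (f s) \<le> B"
      using causal_bounded_bound[OF f] by blast
    have "norm (transpose (f t)) \<le> B * C" if "t \<le> T" for t
      using C(2)[of "f t"] mult_right_mono[OF B(2)[OF that] C(1)] by linarith
    then show ?thesis by blast
  qed
  then show "causal_bounded (\<lambda>t. transpose (f t))"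
    using causal_boundedD(2)[OF f] by (auto simp: causal_bounded_def transpose_0)
next
  assume g: "causal_integrable g"
  note [measurable] = causal_integrableD(1)[OF g]
  have "integrable lborel (\<lambda>t. indicator {..T} t *\<^sub>R transpose (g t))" for T
    using integrable_bounded_linear[OF bounded_linear_transpose causal_integrableD(3)[OF g, of T]]
    by (simp add: transpose_scaleR)
  then show "causal_integrable (\<lambda>t. transpose (g t))"
    using causal_integrableD(2)[OF g] by (auto simp: causal_integrable_def transpose_0)
qed

text \<open>The integrable factor may stand on the left as well: transpose the product and reflect the
  integration variable.\<close>

lemma conv_integrable_swapped:
  fixes f g :: "real \<Rightarrow> real^'n^'n"
  assumes f: "causal_bounded f" and g: "causal_integrable g"
  shows "integrable lborel (\<lambda>s. g (t - s) ** f s)"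
proof -
  have "integrable lborel (\<lambda>s. transpose (f (t - s)) ** transpose (g s))"
    by (rule conv_integrable[OF causal_transpose(1)[OF f] causal_transpose(2)[OF g]])
  then have "integrable lborel (\<lambda>s. g s ** f (t - s))"
    using integrable_bounded_linear[OF bounded_linear_transpose]
    by (fastforce simp: matrix_transpose_mul)
  then show ?thesis
    using lborel_integrable_real_affine_iff[of "-1" "\<lambda>s. g s ** f (t - s)" t] by simp
qed

lemma conv_negative:
  fixes f g :: "real \<Rightarrow> real^'n^'n"
  assumes f: "causal_bounded f" and g: "causal_integrable g" and "t < 0"
  shows "conv f g t = 0"
proof -
  have "f (t - s) ** g s = 0" for s
    using causal_boundedD(2)[OF f, of "t - s"] causal_integrableD(2)[OF g, of s] \<open>t < 0\<close>
    by (cases "s < 0") (auto simp: mm.zero_left mm.zero_right)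
  then show ?thesis by (simp add: conv_def)
qed

lemma conv_bounded:
  fixes f g :: "real \<Rightarrow> real^'n^'n"
  assumes f: "causal_bounded f" and g: "causal_integrable g"
  shows "causal_bounded (conv f g)"
  unfolding causal_bounded_def
proof (intro conjI allI impI)
  note [measurable] = causal_boundedD(1)[OF f] causal_integrableD(1)[OF g]
  show "conv f g \<in> borel_measurable borel" unfolding conv_def[abs_def] by measurable
  show "conv f g t = 0" if "t < 0" for t using conv_negative[OF f g that] .
  fix T
  obtain C where C: "C > 0" "\<And>(X :: real^'n^'n) (Y :: real^'n^'n). norm (X ** Y) \<le> C * (norm X * norm Y)"
    using matrix_mult_bound by metis
  obtain B where B: "B \<ge> 0" "\<And>s. s \<le> T \<Longrightarrow> norm (f s) \<le> B"
    using causal_bounded_bound[OF f] by blast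
  have "norm (conv f g t) \<le> (\<integral>s. norm ((C * B) *\<^sub>R (indicator {..T} s *\<^sub>R g s)) \<partial>lborel)" if "t \<le> T" for t
    unfolding conv_def
  proof (rule Bochner_Integration.integral_norm_bound_integral)
    show "integrable lborel (\<lambda>s. f (t - s) ** g s)" by (rule conv_integrable[OF f g])
    show "integrable lborel (\<lambda>s. norm ((C * B) *\<^sub>R (indicator {..T} s *\<^sub>R g s)))"
      using causal_integrableD(3)[OF g] by (intro integrable_norm integrable_scaleR_right) auto
    fix s
    show "norm (f (t - s) ** g s) \<le> norm ((C * B) *\<^sub>R (indicator {..T} s *\<^sub>R g s))"
    proof (cases "s < 0 \<or> s > T")
      case True
      then have "f (t - s) ** g s = 0" using \<open>t \<le> T\<close>
        using causal_boundedD(2)[OF f, of "t - s"] causal_integrableD(2)[OF g, of s]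
        by (auto simp: mm.zero_left mm.zero_right)
      then show ?thesis by simp
    next
      case False
      have "norm (f (t - s) ** g s) \<le> C * (norm (f (t - s)) * norm (g s))" by (rule C)
      also have "\<dots> \<le> C * (B * norm (g s))"
        using False C B \<open>t \<le> T\<close> by (intro mult_left_mono mult_right_mono) auto
      finally show ?thesis using False B C by (auto simp: mult_ac)
    qed
  qed
  then show "\<exists>B. \<forall>t\<le>T. norm (conv f g t) \<le> B" by blast
qed

text \<open>Fubini's theorem, applied to f(t - v) g(v - u) k(u). The integrand is nonzero only for
  0 \<le> u \<le> v \<le> t, where f and k are bounded, so integrability of g suffices; this matters because
  the distributed delay is merely integrable.\<close>

lemma conv_assoc:
  fixes f g k :: "real \<Rightarrow> real^'n^'n"
  assumes f: "causal_bounded f" and g: "causal_integrable g" and k: "causal_bounded k"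
  shows "conv (conv f g) k t = conv f (conv g k) t"
proof -
  note [measurable] = causal_boundedD(1)[OF f] causal_integrableD(1)[OF g] causal_boundedD(1)[OF k]
  note k' = causal_bounded_imp_integrable[OF k]
  obtain C where C: "C > 0" "\<And>(X :: real^'n^'n) (Y :: real^'n^'n). norm (X ** Y) \<le> C * (norm X * norm Y)"
    using matrix_mult_bound by metis
  obtain B where B: "B \<ge> 0" "\<And>s. s \<le> t \<Longrightarrow> norm (f s) \<le> B"
    using causal_bounded_bound[OF f] by blast
  define F where "F = (\<lambda>u v. f (t - v) ** g (v - u) ** k u)"
  define c where "c = (\<integral>s. norm (indicator {..t} s *\<^sub>R g s) \<partial>lborel)"
  have shift: "F u (u + s) = f (t - u - s) ** g s ** k u" for u s
    by (simp add: F_def algebra_simps)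
  have Fu: "integrable lborel (F u)" for u
  proof -
    have "integrable lborel (\<lambda>s. f (t - u - s) ** g s)" by (rule conv_integrable[OF f g])
    then have "integrable lborel (\<lambda>s. F u (u + s))"
      unfolding shift by (rule integrable_bounded_linear[OF mm.bounded_linear_left])
    then show ?thesis
      using lborel_integrable_real_affine_iff[of 1 "F u" u] by (simp add: add.commute)
  qed
  have zero: "F u v = 0" if "u < 0 \<or> u > t" for u v
    using that causal_boundedD(2)[OF f, of "t - v"] causal_integrableD(2)[OF g, of "v - u"]
      causal_boundedD(2)[OF k, of u]
    by (cases "v > t"; cases "v < u") (auto simp: F_def mm.zero_left mm.zero_right)
  have Fnorm: "(\<integral>v. norm (F u v) \<partial>lborel) \<le> C * C * B * c * norm (indicator {..t} u *\<^sub>R k u)" for u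
  proof (cases "u < 0 \<or> u > t")
    case True
    then show ?thesis using zero[OF True] B C by (simp add: c_def)
  next
    case False
    have "(\<integral>v. norm (F u v) \<partial>lborel) \<le>
        (\<integral>v. C * C * B * norm (k u) * norm (indicator {..t} (- u + v) *\<^sub>R g (- u + v)) \<partial>lborel)"
    proof (rule integral_mono)
      show "integrable lborel (\<lambda>v. norm (F u v))" using Fu by auto
      show "integrable lborel (\<lambda>v. C * C * B * norm (k u) * norm (indicator {..t} (- u + v) *\<^sub>R g (- u + v)))"
        using lborel_integrable_real_affine[OF causal_integrableD(3)[OF g, of t], of 1 "-u"]
        by (intro integrable_mult_right integrable_norm) simp
      fix v
      show "norm (F u v) \<le> C * C * B * norm (k u) * norm (indicator {..t} (- u + v) *\<^sub>R g (- u + v))"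
      proof (cases "v > t \<or> v < u")
        case True
        then have "F u v = 0"
          using causal_boundedD(2)[OF f, of "t - v"] causal_integrableD(2)[OF g, of "v - u"]
          by (auto simp: F_def mm.zero_left mm.zero_right)
        then show ?thesis using B C by simp
      next
        case False
        have "norm (F u v) \<le> C * (norm (f (t - v) ** g (v - u)) * norm (k u))"
          unfolding F_def by (rule C)
        also have "\<dots> \<le> C * ((C * (norm (f (t - v)) * norm (g (v - u)))) * norm (k u))"
          using C by (intro mult_left_mono mult_right_mono) auto
        also have "\<dots> \<le> C * ((C * (B * norm (g (v - u)))) * norm (k u))"
          using C B False \<open>\<not> (u < 0 \<or> u > t)\<close> by (intro mult_left_mono mult_right_mono) auto
        finally show ?thesis using False \<open>\<not> (u < 0 \<or> u > t)\<close> by (simp add: mult_ac)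
      qed
    qed
    also have "\<dots> = C * C * B * norm (k u) * c"
      unfolding c_def
      by (subst (2) lborel_integral_real_affine[where c = 1 and t = "-u"]) auto
    finally show ?thesis using False by (simp add: mult_ac)
  qed
  have intF: "integrable (lborel \<Otimes>\<^sub>M lborel) (\<lambda>(u, v). F u v)"
  proof (rule lborel_pair.Fubini_integrable)
    show "(\<lambda>(u, v). F u v) \<in> borel_measurable (lborel \<Otimes>\<^sub>M lborel)"
      unfolding F_def by measurable
    show "integrable lborel (\<lambda>u. \<integral>v. norm (case (u, v) of (u, v) \<Rightarrow> F u v) \<partial>lborel)"
    proof (rule Bochner_Integration.integrable_bound)
      show "integrable lborel (\<lambda>u. C * C * B * c * norm (indicator {..t} u *\<^sub>R k u))"
        using causal_integrableD(3)[OF k', of t] by (intro integrable_mult_right integrable_norm)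
      show "AE u in lborel. norm (\<integral>v. norm (case (u, v) of (u, v) \<Rightarrow> F u v) \<partial>lborel)
          \<le> norm (C * C * B * c * norm (indicator {..t} u *\<^sub>R k u))"
        using Fnorm by (intro AE_I2) (auto intro: order_trans[OF _ abs_ge_self])
      show "(\<lambda>u. \<integral>v. norm (case (u, v) of (u, v) \<Rightarrow> F u v) \<partial>lborel) \<in> borel_measurable lborel"
        unfolding F_def by measurable
    qed
    show "AE u in lborel. integrable lborel (\<lambda>v. case (u, v) of (u, v) \<Rightarrow> F u v)" using Fu by simp
  qed
  have "conv (conv f g) k t = (\<integral>u. (\<integral>v. F u v \<partial>lborel) \<partial>lborel)"
    unfolding conv_def[of _ k]
  proof (rule Bochner_Integration.integral_cong[OF refl])
    fix u
    have "conv f g (t - u) ** k u = (\<integral>s. f (t - u - s) ** g s ** k u \<partial>lborel)"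
      unfolding conv_def
      by (rule integral_bounded_linear[OF mm.bounded_linear_left conv_integrable[OF f g], symmetric])
    also have "\<dots> = (\<integral>v. F u v \<partial>lborel)"
      by (subst lborel_integral_real_affine[where c = 1 and t = u and f = "F u"]) (auto simp: shift)
    finally show "conv f g (t - u) ** k u = (\<integral>v. F u v \<partial>lborel)" .
  qed
  also have "\<dots> = (\<integral>v. (\<integral>u. F u v \<partial>lborel) \<partial>lborel)"
    using lborel_pair.Fubini_integral[OF intF] by simp
  also have "\<dots> = conv f (conv g k) t"
    unfolding conv_def[of f "conv g k"]
  proof (rule Bochner_Integration.integral_cong[OF refl])
    fix v
    show "(\<integral>u. F u v \<partial>lborel) = f (t - v) ** conv g k v"
      unfolding conv_def[of g k] F_def
      using integral_bounded_linear[OF mm.bounded_linear_right conv_integrable_swapped[OF k g, of v], of "f (t - v)"]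
      by (simp add: matrix_mul_assoc)
  qed
  finally show ?thesis .
qed

section \<open>Convolution with the Heaviside function\<close>

definition heaviside :: "real \<Rightarrow> real^'n^'n" where
  "heaviside t = (if t < 0 then 0 else mat 1)"

text \<open>The Heaviside function takes only the values 0 and 1 times the identity, hence it is central. This is why
  the left and the right resolvent of the same kernel can agree.\<close>

lemma heaviside_commute: "heaviside t ** X = X ** heaviside t"
  by (simp add: heaviside_def mm.zero_left mm.zero_right)

lemma causal_bounded_heaviside: "causal_bounded (heaviside :: real \<Rightarrow> real^'n^'n)"
  unfolding causal_bounded_def
proof (intro conjI allI impI)
  show "(heaviside :: real \<Rightarrow> real^'n^'n) \<in> borel_measurable borel"
    unfolding heaviside_def[abs_def] by measurable
  show "\<exists>B. \<forall>t\<le>T. norm (heaviside t :: real^'n^'n) \<le> B" for T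
    by (rule exI[of _ "norm (mat 1 :: real^'n^'n)"]) (auto simp: heaviside_def)
qed (auto simp: heaviside_def)

lemma conv_heaviside_commute: "conv f heaviside t = conv heaviside f t"
  by (subst conv_commuted) (simp add: conv_def heaviside_commute)

lemma conv_add_left:
  assumes "causal_bounded f" "causal_bounded f'" "causal_integrable g"
  shows "conv (\<lambda>t. f t + f' t) g t = conv f g t + conv f' g t"
  using conv_integrable[OF assms(1,3), of t] conv_integrable[OF assms(2,3), of t]
  by (simp add: conv_def mm.add_left)

lemma conv_diff_left:
  assumes "causal_bounded f" "causal_bounded f'" "causal_integrable g"
  shows "conv (\<lambda>t. f t - f' t) g t = conv f g t - conv f' g t"
  using conv_integrable[OF assms(1,3), of t] conv_integrable[OF assms(2,3), of t]
  by (simp add: conv_def mm.diff_left)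

lemma conv_add_right:
  assumes "causal_bounded f" "causal_integrable g" "causal_integrable g'"
  shows "conv f (\<lambda>t. g t + g' t) t = conv f g t + conv f g' t"
  using conv_integrable[OF assms(1,2), of t] conv_integrable[OF assms(1,3), of t]
  by (simp add: conv_def mm.add_right)

lemma causal_bounded_add:
  assumes "causal_bounded f" "causal_bounded g"
  shows "causal_bounded (\<lambda>t. f t + g t :: real^'n^'n)"
proof -
  note [measurable] = assms[THEN causal_boundedD(1)]
  have "\<exists>B. \<forall>t\<le>T. norm (f t + g t) \<le> B" for T
  proof -
    obtain B1 where "\<And>s. s \<le> T \<Longrightarrow> norm (f s) \<le> B1" using causal_bounded_bound[OF assms(1)] by blast
    moreover obtain B2 where "\<And>s. s \<le> T \<Longrightarrow> norm (g s) \<le> B2" using causal_bounded_bound[OF assms(2)] by blast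
    ultimately show ?thesis by (intro exI[of _ "B1 + B2"]) (auto intro: norm_triangle_mono)
  qed
  then show ?thesis using assms[THEN causal_boundedD(2)] by (auto simp: causal_bounded_def)
qed

lemma causal_bounded_linear_image:
  fixes f :: "real \<Rightarrow> real^'n^'n" and L :: "real^'n^'n \<Rightarrow> real^'n^'n"
  assumes f: "causal_bounded f" and L: "bounded_linear L"
  shows "causal_bounded (\<lambda>t. L (f t))"
proof -
  note [measurable] = causal_boundedD(1)[OF f]
  have [measurable]: "L \<in> borel_measurable borel"
    by (intro borel_measurable_continuous_onI bounded_linear.continuous_on[OF L] continuous_intros)
  obtain C where C: "C \<ge> 0" "\<And>X. norm (L X) \<le> norm X * C"
    using bounded_linear.nonneg_bounded[OF L] by blast
  have "\<exists>B. \<forall>t\<le>T. norm (L (f t)) \<le> B" for T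
  proof -
    obtain B where B: "B \<ge> 0" "\<And>s. s \<le> T \<Longrightarrow> norm (f s) \<le> B"
      using causal_bounded_bound[OF f] by blast
    have "norm (L (f t)) \<le> B * C" if "t \<le> T" for t
      using C(2)[of "f t"] mult_right_mono[OF B(2)[OF that] C(1)] by linarith
    then show ?thesis by blast
  qed
  then show ?thesis
    using causal_boundedD(2)[OF f] linear_0[OF bounded_linear.linear[OF L]]
    by (auto simp: causal_bounded_def)
qed

lemma causal_bounded_delay:
  assumes "causal_bounded f" "h \<ge> 0"
  shows "causal_bounded (\<lambda>t. f (t - h))"
proof -
  note [measurable] = causal_boundedD(1)[OF assms(1)]
  have "\<exists>B. \<forall>t\<le>T. norm (f (t - h)) \<le> B" for T
  proof -
    obtain B where "\<And>s. s \<le> T \<Longrightarrow> norm (f s) \<le> B" using causal_bounded_bound[OF assms(1)] by blast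
    then show ?thesis using assms(2) by (intro exI[of _ B]) auto
  qed
  then show ?thesis using causal_boundedD(2)[OF assms(1)] assms(2) by (auto simp: causal_bounded_def)
qed

lemma causal_bounded_continuous:
  fixes f :: "real \<Rightarrow> real^'n^'n"
  assumes cont: "continuous_on {0..} f" and zero: "\<And>t. t < 0 \<Longrightarrow> f t = 0"
  shows "causal_bounded f"
  unfolding causal_bounded_def
proof (intro conjI allI impI zero)
  have "(\<lambda>t. indicator {0..} t *\<^sub>R f t) \<in> borel_measurable borel"
    by (rule borel_measurable_continuous_on_indicator[OF _ cont]) auto
  also have "(\<lambda>t. indicator {0..} t *\<^sub>R f t) = f"
    using zero by (auto simp: indicator_def fun_eq_iff not_le)
  finally show "f \<in> borel_measurable borel" .
  fix T
  have "compact (f ` {0..T})"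
    by (intro compact_continuous_image continuous_on_subset[OF cont]) auto
  then obtain B where B: "\<And>t. t \<in> {0..T} \<Longrightarrow> norm (f t) \<le> B"
    using compact_imp_bounded by (fastforce simp: bounded_iff)
  then have "norm (f t) \<le> max B 0" if "t \<le> T" for t
    using that zero[of t] by (cases "t < 0") (auto simp: le_max_iff_disj)
  then show "\<exists>B. \<forall>t\<le>T. norm (f t) \<le> B" by blast
qed

text \<open>Near a time t0 only the values of f and g on times below T = t0 + 1 enter, so both functions can be
  truncated at T; the truncated integrand is dominated by a multiple of the integrable truncation
  of g.\<close>

lemma conv_continuous:
  fixes f g :: "real \<Rightarrow> real^'n^'n"
  assumes f: "causal_bounded f" "continuous_on {0..} f" and g: "causal_integrable g"
  shows "continuous_on UNIV (conv f g)"
proof (intro continuous_at_imp_continuous_on ballI)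
  fix t0 :: real
  define T where "T = t0 + 1"
  note [measurable] = causal_boundedD(1)[OF f(1)] causal_integrableD(1)[OF g]
  obtain C where C: "C > 0" "\<And>(X :: real^'n^'n) (Y :: real^'n^'n). norm (X ** Y) \<le> C * (norm X * norm Y)"
    using matrix_mult_bound by metis
  obtain B where B: "B \<ge> 0" "\<And>s. s \<le> T \<Longrightarrow> norm (f s) \<le> B"
    using causal_bounded_bound[OF f(1)] by blast
  define fT where "fT x = f (min x T)" for x
  define gT where "gT x = indicator {..T} x *\<^sub>R g x" for x
  have fT_cont: "isCont fT x" if "x \<noteq> 0" for x
  proof (cases "x < 0 \<or> T < 0")
    case True
    then have "eventually (\<lambda>y. fT y = 0) (nhds x)"
    proof
      assume "x < 0"
      then have "eventually (\<lambda>y. y < 0) (nhds x)" by (intro order_tendstoD) (auto intro: tendsto_ident_at filterlim_ident)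
      then show ?thesis by eventually_elim (use causal_boundedD(2)[OF f(1)] in \<open>auto simp: fT_def min_def\<close>)
    next
      assume "T < 0"
      then have "fT y = 0" for y
        using causal_boundedD(2)[OF f(1)] by (auto simp: fT_def min_def)
      then show ?thesis by simp
    qed
    then show ?thesis using isCont_cong[of fT "\<lambda>_. 0" x] by simp
  next
    case False
    then have "x > 0" using that by auto
    have "continuous_on {0..} fT"
      unfolding fT_def using False by (intro continuous_on_compose2[OF f(2)] continuous_intros) auto
    then have "continuous_on {0<..} fT" by (rule continuous_on_subset) auto
    then show ?thesis using \<open>x > 0\<close> by (simp add: continuous_on_eq_continuous_at)
  qed
  have cont_int: "isCont (\<lambda>t. \<integral>s. fT (t - s) ** gT s \<partial>lborel) t0"
  proof (rule isCont_integral_dominated[where w = "\<lambda>s. C * B * norm (gT s)"])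
    show "(\<lambda>s. fT (t - s) ** gT s) \<in> borel_measurable lborel" for t
      unfolding fT_def gT_def by measurable
    show "integrable lborel (\<lambda>s. C * B * norm (gT s))"
      unfolding gT_def using causal_integrableD(3)[OF g, of T] by (intro integrable_mult_right integrable_norm)
    show "AE s in lborel. norm (fT (t - s) ** gT s) \<le> C * B * norm (gT s)" for t
    proof (intro AE_I2)
      fix s
      have "norm (fT (t - s) ** gT s) \<le> C * (norm (fT (t - s)) * norm (gT s))" by (rule C)
      also have "\<dots> \<le> C * (B * norm (gT s))"
        using C B by (intro mult_left_mono mult_right_mono) (auto simp: fT_def)
      finally show "norm (fT (t - s) ** gT s) \<le> C * B * norm (gT s)" by (simp add: mult_ac)
    qed
    have "AE s in lborel. s \<noteq> t0" by (rule AE_lborel_singleton)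
    then show "AE s in lborel. isCont (\<lambda>t. fT (t - s) ** gT s) t0"
    proof eventually_elim
      case (elim s)
      then have "isCont (\<lambda>t. fT (t - s)) t0"
        by (intro isCont_o2[OF _ fT_cont] continuous_intros) auto
      then show ?case by (intro mm.continuous continuous_const) auto
    qed
  qed
  have "(\<integral>s. fT (t - s) ** gT s \<partial>lborel) = conv f g t" if "t < T" for t
    unfolding conv_def
  proof (rule Bochner_Integration.integral_cong[OF refl])
    fix s
    consider "s < 0" | "s > T" | "0 \<le> s" "s \<le> T" by linarith
    then show "fT (t - s) ** gT s = f (t - s) ** g s"
      using \<open>t < T\<close> causal_boundedD(2)[OF f(1), of "t - s"] causal_integrableD(2)[OF g, of s]
      by cases (auto simp: fT_def gT_def mm.zero_left mm.zero_right)
  qed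
  moreover have "eventually (\<lambda>t. t < T) (nhds t0)"
    unfolding T_def by (intro order_tendstoD) (auto intro: tendsto_ident_at filterlim_ident)
  ultimately have "eventually (\<lambda>t. (\<integral>s. fT (t - s) ** gT s \<partial>lborel) = conv f g t) (nhds t0)"
    by (auto elim: eventually_mono)
  from isCont_cong[OF this] cont_int show "isCont (conv f g) t0" by simp
qed

lemma conv_heaviside_eq_integral:
  fixes f :: "real \<Rightarrow> real^'n^'n"
  assumes f: "causal_bounded f" and "t \<ge> 0"
  shows "conv f heaviside t = integral {0..t} f"
proof -
  note f' = causal_bounded_imp_integrable[OF f]
  have eq: "f s ** heaviside (t - s) = indicator {0..t} s *\<^sub>R f s" for s
    using causal_boundedD(2)[OF f] by (auto simp: heaviside_def indicator_def not_le mm.zero_right)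
  have ind: "indicator {..t} s *\<^sub>R f s = indicator {0..t} s *\<^sub>R f s" for s
    using causal_boundedD(2)[OF f] by (auto simp: indicator_def not_le)
  have "set_integrable lborel {0..t} f"
    unfolding set_integrable_def using causal_integrableD(3)[OF f', of t] by (simp only: ind)
  from set_borel_integral_eq_integral(2)[OF this] show ?thesis
    by (simp add: conv_commuted eq set_lebesgue_integral_def)
qed

text \<open>Convolution with the Heaviside function is integration from 0, which is undone by
  differentiation.\<close>

lemma continuous_eq_of_conv_heaviside:
  fixes f k :: "real \<Rightarrow> real^'n^'n"
  assumes f: "causal_bounded f" "continuous_on {0..} f"
    and k: "causal_bounded k" "continuous_on {0..} k"
    and eq: "\<And>t. conv f heaviside t = conv k heaviside t"
  shows "f = k"
proof
  fix t
  show "f t = k t"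
  proof (cases "t < 0")
    case True
    then show ?thesis using causal_boundedD(2)[OF f(1)] causal_boundedD(2)[OF k(1)] by simp
  next
    case False
    have D: "((\<lambda>u. integral {0..u} f) has_vector_derivative f t) (at t within {0..t+1})"
      "((\<lambda>u. integral {0..u} k) has_vector_derivative k t) (at t within {0..t+1})"
      using False by (auto intro!: integral_has_vector_derivative continuous_on_subset[OF f(2)] continuous_on_subset[OF k(2)])
    have "((\<lambda>u. integral {0..u} f) has_vector_derivative k t) (at t within {0..t+1})"
    proof (rule has_vector_derivative_transform[OF _ _ D(2)])
      fix u assume "u \<in> {0..t+1}"
      then show "integral {0..u} f = integral {0..u} k"
        using eq[of u] by (simp add: conv_heaviside_eq_integral[OF f(1)] conv_heaviside_eq_integral[OF k(1)])
    qed (use False in auto)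
    then show ?thesis
      using False vector_derivative_unique_within_closed_interval[of 0 "t+1" t _ "f t" "k t"] D(1) by auto
  qed
qed

lemma integrable_exp_Ici:
  fixes c :: real assumes "c > 0"
  shows "has_bochner_integral lborel (\<lambda>s. indicator {0..} s * exp (- (c * s))) (1 / c)"
proof (rule has_bochner_integral_nn_integral)
  have "(\<integral>\<^sup>+s. ennreal (exp (- (c * s))) * indicator {0..} s \<partial>lborel) = ennreal (0 - (- exp (- (c * 0)) / c))"
  proof (rule nn_integral_FTC_atLeast)
    show "((\<lambda>s. - exp (- (c * s)) / c) \<longlongrightarrow> 0) at_top"
    proof -
      have "((\<lambda>s. exp (- (c * s))) \<longlongrightarrow> 0) at_top"
        by (rule filterlim_compose[OF exp_at_bot])
          (use assms in \<open>auto intro!: filterlim_tendsto_pos_mult_at_top[OF tendsto_const] filterlim_ident simp: filterlim_uminus_at_bot\<close>)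
      from tendsto_divide[OF tendsto_minus[OF this] tendsto_const[of c]] assms show ?thesis by simp
    qed
  qed (use assms in \<open>auto intro!: derivative_eq_intros\<close>)
  then show "(\<integral>\<^sup>+s. ennreal (indicator {0..} s * exp (- (c * s))) \<partial>lborel) = ennreal (1 / c)"
    using assms by (simp add: ennreal_mult' ennreal_indicator mult.commute)
qed (use assms in auto)


section \<open>Resolvents of Volterra kernels\<close>

lemma norm_conv_le:
  fixes f g :: "real \<Rightarrow> real^'n^'n"
  assumes f: "causal_bounded f" and bound: "\<And>s. norm (f s) \<le> m" and g: "causal_integrable g" "integrable lborel g"
    and C: "C \<ge> 0" "\<And>(X :: real^'n^'n) (Y :: real^'n^'n). norm (X ** Y) \<le> C * (norm X * norm Y)"
  shows "norm (conv f g t) \<le> C * m * (\<integral>s. norm (g s) \<partial>lborel)"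
proof -
  have "norm (conv f g t) \<le> (\<integral>s. C * m * norm (g s) \<partial>lborel)"
    unfolding conv_def
  proof (rule Bochner_Integration.integral_norm_bound_integral[OF conv_integrable[OF f g(1)]])
    show "integrable lborel (\<lambda>s. C * m * norm (g s))" using g(2) by auto
    fix s
    have "norm (f (t - s) ** g s) \<le> C * (norm (f (t - s)) * norm (g s))" by (rule C)
    also have "\<dots> \<le> C * (m * norm (g s))"
      using C bound by (intro mult_left_mono mult_right_mono) auto
    finally show "norm (f (t - s) ** g s) \<le> C * m * norm (g s)" by (simp add: mult_ac)
  qed
  then show ?thesis by simp
qed

text \<open>With y(t) = exp(- c t) K(t), the equation K = H + K * N becomes a fixed point equation for a map on
  the bounded continuous functions whose kernel is exp(- c s) N(s). Its integral is at most b / c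
  in norm, so for large c the map is a contraction.\<close>

lemma volterra_exists:
  fixes N :: "real \<Rightarrow> real^'n^'n"
  assumes N: "causal_bounded N" and bound: "\<And>s. norm (N s) \<le> b"
  obtains K where "continuous_on {0..} K" "\<And>t. t < 0 \<Longrightarrow> K t = 0"
    "\<And>t. K t = heaviside t + conv K N t"
proof -
  note [measurable] = causal_boundedD(1)[OF N]
  obtain C where C: "C > 0" "\<And>(X :: real^'n^'n) (Y :: real^'n^'n). norm (X ** Y) \<le> C * (norm X * norm Y)"
    using matrix_mult_bound by metis
  have b: "b \<ge> 0" using order_trans[OF norm_ge_zero bound] .
  \<comment> \<open>The weight is chosen such that C * b / c is below 1/2; adding 1 keeps it positive when b = 0.\<close>
  define c where "c = 2 * C * b + 1"
  have c: "c > 0" using C(1) b by (simp add: c_def add_nonneg_pos)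
  define N' where "N' = (\<lambda>s. exp (- (c * s)) *\<^sub>R N s)"
  define I where "I = (\<integral>s. norm (N' s) \<partial>lborel)"
  note E = integrable_exp_Ici[OF c]
  have N'_bound: "norm (N' s) \<le> b * (indicator {0..} s * exp (- (c * s)))" for s
    using bound[of s] causal_boundedD(2)[OF N, of s] b
    by (auto simp: N'_def indicator_def not_le mult.commute)
  have N'_int: "integrable lborel N'"
  proof (rule Bochner_Integration.integrable_bound)
    show "integrable lborel (\<lambda>s. b * (indicator {0..} s * exp (- (c * s))))"
      using E by (auto simp: has_bochner_integral_iff)
    show "N' \<in> borel_measurable lborel" unfolding N'_def by measurable
    show "AE s in lborel. norm (N' s) \<le> norm (b * (indicator {0..} s * exp (- (c * s))))"
      using N'_bound by (intro AE_I2) (auto intro: order_trans[OF _ abs_ge_self])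
  qed
  have N': "causal_integrable N'"
    unfolding causal_integrable_def
  proof (intro conjI allI impI)
    show "integrable lborel (\<lambda>t. indicator {..T} t *\<^sub>R N' t)" for T
      using N'_int by (intro integrable_mult_indicator) auto
    show "N' \<in> borel_measurable borel" unfolding N'_def by measurable
  qed (use causal_boundedD(2)[OF N] in \<open>auto simp: N'_def\<close>)
  have "I \<le> (\<integral>s. b * (indicator {0..} s * exp (- (c * s))) \<partial>lborel)"
    unfolding I_def using N'_bound E N'_int by (intro integral_mono) (auto simp: has_bochner_integral_iff)
  also have "\<dots> = b / c" using E by (simp add: has_bochner_integral_iff)
  finally have "C * I \<le> C * (b / c)" using C(1) by (intro mult_left_mono) auto
  also have "\<dots> \<le> 1 / 2" using c by (simp add: c_def field_simps)
  finally have CI: "C * I \<le> 1 / 2" .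
  have I0: "I \<ge> 0" unfolding I_def by simp

  \<comment> \<open>The contraction acts on functions on the whole line: the argument is cut off below 0 to make it
    causal, and the value is extended constantly below 0 to keep it continuous.\<close>
  define cut where "cut y t = (if t < 0 then 0 else y t)" for y :: "real \<Rightarrow> real^'n^'n" and t
  have cut: "causal_bounded (cut y)" "continuous_on {0..} (cut y)" if "continuous_on UNIV y" for y
  proof -
    show *: "continuous_on {0..} (cut y)"
      using continuous_on_subset[OF that, of "{0..}"] by (rule continuous_on_eq) (auto simp: cut_def)
    show "causal_bounded (cut y)" by (rule causal_bounded_continuous[OF *]) (simp add: cut_def)
  qed
  define \<Phi> where "\<Phi> y t = exp (- (c * max 0 t)) *\<^sub>R mat 1 + conv (cut y) N' (max 0 t)"
    for y :: "real \<Rightarrow> real^'n^'n" and t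
  have young: "norm (conv f N' t) \<le> C * m * I" if "causal_bounded f" "\<And>s. norm (f s) \<le> m" for f m t
    unfolding I_def using norm_conv_le[OF that N' N'_int _ C(2)] C(1) by simp
  have \<Phi>_bcont: "\<Phi> y \<in> bcontfun" if y': "y \<in> bcontfun" for y
  proof -
    have y: "continuous_on UNIV y" using y' by (simp add: bcontfun_def)
    obtain m where m: "\<And>s. norm (y s) \<le> m"
      using y' by (auto simp: bcontfun_def bounded_iff)
    have m0: "0 \<le> m" using order_trans[OF norm_ge_zero m] .
    have "norm (\<Phi> y t) \<le> norm (mat 1 :: real^'n^'n) + C * m * I" for t
    proof -
      have "norm (exp (- (c * max 0 t)) *\<^sub>R (mat 1 :: real^'n^'n)) \<le> 1 * norm (mat 1 :: real^'n^'n)"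
        unfolding norm_scaleR using c by (intro mult_right_mono) auto
      moreover have "norm (conv (cut y) N' (max 0 t)) \<le> C * m * I"
        using m m0 by (intro young cut(1)[OF y]) (auto simp: cut_def)
      ultimately show ?thesis unfolding \<Phi>_def by (intro norm_triangle_mono) auto
    qed
    moreover have "continuous_on UNIV (\<Phi> y)"
      unfolding \<Phi>_def
      by (intro continuous_intros continuous_on_compose2[OF conv_continuous[OF cut(1)[OF y] cut(2)[OF y] N']]) auto
    ultimately show ?thesis by (auto simp: bcontfun_def bounded_iff)
  qed
  define \<Psi> where "\<Psi> y = Bcontfun (\<Phi> (apply_bcontfun y))" for y
  have \<Psi>: "apply_bcontfun (\<Psi> y) = \<Phi> (apply_bcontfun y)" for y
    unfolding \<Psi>_def by (rule Bcontfun_inverse[OF \<Phi>_bcont[OF apply_bcontfun]])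
  have "dist (\<Psi> y) (\<Psi> z) \<le> 1 / 2 * dist y z" for y z
  proof (rule dist_bound)
    fix t
    have "dist (\<Psi> y t) (\<Psi> z t) = norm (conv (cut y) N' (max 0 t) - conv (cut z) N' (max 0 t))"
      by (simp add: \<Psi> \<Phi>_def dist_norm)
    also have "\<dots> = norm (conv (\<lambda>t. cut y t - cut z t) N' (max 0 t))"
      by (simp add: conv_diff_left[OF cut(1) cut(1) N'])
    also have "\<dots> \<le> C * dist y z * I"
    proof (rule young)
      have "(\<lambda>t. cut y t - cut z t) = cut (\<lambda>t. y t - z t)" by (auto simp: cut_def)
      then show "causal_bounded (\<lambda>t. cut y t - cut z t)"
        using cut(1)[of "\<lambda>t. y t - z t"] by (simp add: continuous_on_diff)
      show "norm (cut y s - cut z s) \<le> dist y z" for s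
        using dist_bounded[of y s z] by (auto simp: cut_def dist_norm)
    qed
    also have "\<dots> = (C * I) * dist y z" by simp
    also have "\<dots> \<le> 1 / 2 * dist y z" using CI by (intro mult_right_mono) auto
    finally show "dist (\<Psi> y t) (\<Psi> z t) \<le> 1 / 2 * dist y z" .
  qed
  then obtain y where y: "\<Psi> y = y"
    using banach_fix_type[of "1/2" \<Psi>] by auto
  have y_eq: "y t = \<Phi> y t" for t using \<Psi>[of y] by (simp add: y)
  define K where "K t = (if t < 0 then 0 else exp (c * t) *\<^sub>R y t)" for t
  have K_cont: "continuous_on {0..} K"
  proof (rule continuous_on_eq)
    show "continuous_on {0..} (\<lambda>t. exp (c * t) *\<^sub>R y t)"
      by (intro continuous_intros continuous_on_apply_bcontfun)
  qed (auto simp: K_def)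
  have "K t = heaviside t + conv K N t" for t
  proof (cases "t < 0")
    case True
    have "conv K N t = 0"
      using True by (intro conv_negative[OF causal_bounded_continuous[OF K_cont] causal_bounded_imp_integrable[OF N]])
        (auto simp: K_def)
    then show ?thesis using True by (simp add: K_def heaviside_def)
  next
    case False
    have "K (t - s) ** N s = exp (c * t) *\<^sub>R (cut y (t - s) ** N' s)" for s
    proof -
      have "exp (c * t) * exp (- (c * s)) = exp (c * (t - s))"
        by (simp add: exp_add[symmetric] algebra_simps)
      then show ?thesis
        by (auto simp: K_def cut_def N'_def mm.zero_left mm.scaleR_left mm.scaleR_right)
    qed
    then have "conv K N t = exp (c * t) *\<^sub>R conv (cut y) N' t" by (simp add: conv_def)
    moreover have "exp (c * t) *\<^sub>R exp (- (c * t)) *\<^sub>R (mat 1 :: real^'n^'n) = mat 1"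
      by (simp add: exp_add[symmetric])
    moreover have "y t = exp (- (c * t)) *\<^sub>R mat 1 + conv (cut y) N' t"
      using y_eq[of t] False by (simp add: \<Phi>_def max_def)
    ultimately show ?thesis using False by (simp add: K_def heaviside_def scaleR_add_right)
  qed
  with K_cont show thesis by (intro that[of K]) (auto simp: K_def)
qed

text \<open>Expand K * L in two ways. Inserting the equation of L gives K * H + K * (N * L), inserting that of K
  gives H * L + (K * N) * L. By associativity K * H = H * L, that is, K and L have the same integral.
  So a solution of one equation makes the solution of the other one unique.\<close>

lemma resolvent_left_eq_right:
  fixes N K L :: "real \<Rightarrow> real^'n^'n"
  assumes N: "causal_bounded N"
    and K: "causal_bounded K" "continuous_on {0..} K" "\<And>t. K t = heaviside t + conv K N t"
    and L: "causal_bounded L" "continuous_on {0..} L" "\<And>t. L t = heaviside t + conv N L t"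
  shows "K = L"
proof (rule continuous_eq_of_conv_heaviside[OF K(1,2) L(1,2)])
  fix t
  note i = causal_bounded_imp_integrable
  note H = causal_bounded_heaviside
  have "conv K L t = conv K heaviside t + conv K (conv N L) t"
    using conv_add_right[OF K(1) i[OF H] i[OF conv_bounded[OF N i[OF L(1)]]], of t]
    by (subst L(3)[abs_def]) simp
  moreover have "conv K L t = conv heaviside L t + conv (conv K N) L t"
    using conv_add_left[OF H conv_bounded[OF K(1) i[OF N]] i[OF L(1)], of t]
    by (subst K(3)[abs_def]) simp
  ultimately show "conv K heaviside t = conv L heaviside t"
    using conv_assoc[OF K(1) i[OF N] L(1), of t] by (simp add: conv_heaviside_commute)
qed

section \<open>The distributed delay as a convolution\<close>

text \<open>Shifted products such as g(v - u) are jointly measurable for Borel functions, but not for all Lebesgue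
  measurable ones; hence the distributed delay is first replaced by a Borel function.\<close>

lemma ex_borel_representative:
  fixes G :: "real \<Rightarrow> 'a::euclidean_space"
  assumes "G \<in> borel_measurable lebesgue"
  obtains g where "g \<in> borel_measurable borel" "AE t in lborel. G t = g t"
proof -
  have "\<exists>g\<in>borel_measurable lborel. AE t in lborel. G t \<bullet> b = g t" for b
    by (rule completion_ex_borel_measurable_real, rule borel_measurable_inner[OF assms borel_measurable_const])
  then obtain gb where gb: "\<And>b. gb b \<in> borel_measurable lborel" "\<And>b. AE t in lborel. G t \<bullet> b = gb b t"
    by metis
  note [measurable] = gb(1)
  have "AE t in lborel. \<forall>b\<in>Basis. G t \<bullet> b = gb b t"
    using gb(2) by (intro AE_finite_allI) auto
  then have "AE t in lborel. G t = (\<Sum>b\<in>Basis. gb b t *\<^sub>R b)"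
  proof eventually_elim
    case (elim t)
    then have "(\<Sum>b\<in>Basis. gb b t *\<^sub>R b) = (\<Sum>b\<in>Basis. (G t \<bullet> b) *\<^sub>R b)"
      by (intro sum.cong) auto
    then show ?case by (simp add: euclidean_representation)
  qed
  then show thesis by (intro that[of "\<lambda>t. \<Sum>b\<in>Basis. gb b t *\<^sub>R b"]) measurable
qed

text \<open>A Borel representative of the reflected delay G, extended by 0, so that integrals of K(t + \<theta>) G(\<theta>)
  over [-h, 0] become convolutions K * g.\<close>

definition delay_kernel :: "real \<Rightarrow> (real \<Rightarrow> real^'n^'n) \<Rightarrow> (real \<Rightarrow> real^'n^'n) \<Rightarrow> bool" where
  "delay_kernel h G g \<longleftrightarrow> g \<in> borel_measurable borel \<and> integrable lborel g \<and>
     (\<forall>s. s \<notin> {0..h} \<longrightarrow> g s = 0) \<and>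
     (AE \<theta> in lborel. \<theta> \<in> {-h..0} \<longrightarrow> G \<theta> = g (-\<theta>))"

lemma delay_kernel_exists:
  assumes "integrable (lebesgue_on {-h..0}) G"
  obtains g where "delay_kernel h G g"
proof -
  have int: "integrable lebesgue (\<lambda>\<theta>. indicator {-h..0} \<theta> *\<^sub>R G \<theta>)"
    using assms integrable_restrict_space[of "{-h..0}" lebesgue G] by simp
  obtain k where k: "k \<in> borel_measurable borel"
      "AE t in lborel. indicator {-h..0} t *\<^sub>R G t = k t"
    by (metis ex_borel_representative[OF borel_measurable_integrable[OF int]])
  note [measurable] = k(1)
  define k' where "k' t = indicator {-h..0} t *\<^sub>R k t" for t
  have [measurable]: "k' \<in> borel_measurable borel" unfolding k'_def by measurable
  have AE: "AE t in lborel. indicator {-h..0} t *\<^sub>R G t = k' t"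
    using k(2) by eventually_elim (auto simp: k'_def indicator_def split: if_splits)
  have "integrable lebesgue k'"
    by (rule integrable_cong_AE_imp[OF int measurable_completion AE_completion[OF AE]]) measurable
  then have "integrable lborel k'"
    by (subst (asm) integrable_completion) measurable
  then have "integrable lborel (\<lambda>s. k' (- s))"
    using lborel_integrable_real_affine_iff[of "-1" k' 0] by simp
  then have "delay_kernel h G (\<lambda>s. k' (- s))"
    unfolding delay_kernel_def using AE by (auto simp: k'_def)
  then show thesis by (rule that)
qed

lemma delay_kernel_integrable:
  assumes "delay_kernel h G g" "h > 0"
  shows "causal_integrable g"
  using assms integrable_mult_indicator[of "{..T}" lborel g for T]
  by (auto simp: delay_kernel_def causal_integrable_def)

lemma delay_kernel_transpose:
  assumes "delay_kernel h G g"
  shows "delay_kernel h (\<lambda>\<theta>. transpose (G \<theta>)) (\<lambda>s. transpose (g s))"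
proof -
  have [measurable]: "g \<in> borel_measurable borel" using assms by (simp add: delay_kernel_def)
  have "integrable lborel (\<lambda>s. transpose (g s))"
    using assms integrable_bounded_linear[OF bounded_linear_transpose] by (auto simp: delay_kernel_def)
  then show ?thesis
    using assms by (auto simp: delay_kernel_def transpose_0)
qed

lemma delay_integral_eq_conv:
  fixes k G :: "real \<Rightarrow> real^'n^'n"
  assumes G: "integrable (lebesgue_on {-h..0}) G" and g: "delay_kernel h G g" and k: "k \<in> borel_measurable borel"
  shows "(LINT \<theta>|lebesgue_on {-h..0}. k (t + \<theta>) ** G \<theta>) = conv k g t"
proof -
  note [measurable] = k
  have [measurable]: "g \<in> borel_measurable borel" using g by (simp add: delay_kernel_def)
  have [measurable]: "(\<lambda>\<theta>. indicator {-h..0} \<theta> *\<^sub>R G \<theta>) \<in> borel_measurable lebesgue"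
    using G borel_measurable_restrict_space_iff[of "{-h..0}" lebesgue G] by (auto dest: borel_measurable_integrable)
  have [measurable]: "(\<lambda>\<theta>. k (t + \<theta>)) \<in> borel_measurable lebesgue"
    by (intro measurable_completion) measurable
  have "(LINT \<theta>|lebesgue_on {-h..0}. k (t + \<theta>) ** G \<theta>)
      = (LINT \<theta>|lebesgue. k (t + \<theta>) ** (indicator {-h..0} \<theta> *\<^sub>R G \<theta>))"
    by (subst integral_restrict_space) (auto simp: mm.scaleR_right)
  also have "\<dots> = (LINT \<theta>|lebesgue. k (t + \<theta>) ** g (- \<theta>))"
  proof (rule integral_cong_AE)
    show "(\<lambda>\<theta>. k (t + \<theta>) ** g (- \<theta>)) \<in> borel_measurable lebesgue"
      by (intro measurable_completion) measurable
    have "AE \<theta> in lborel. k (t + \<theta>) ** (indicator {-h..0} \<theta> *\<^sub>R G \<theta>) = k (t + \<theta>) ** g (- \<theta>)"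
    proof -
      have "AE \<theta> in lborel. \<theta> \<in> {-h..0} \<longrightarrow> G \<theta> = g (-\<theta>)" using g by (simp add: delay_kernel_def)
      then show ?thesis
        by eventually_elim (use g in \<open>auto simp: delay_kernel_def indicator_def mm.zero_right\<close>)
    qed
    then show "AE \<theta> in lebesgue. k (t + \<theta>) ** (indicator {-h..0} \<theta> *\<^sub>R G \<theta>) = k (t + \<theta>) ** g (- \<theta>)"
      by (rule AE_completion)
  qed measurable
  also have "\<dots> = (LINT \<theta>|lborel. k (t + \<theta>) ** g (- \<theta>))"
    by (intro integral_completion) measurable
  also have "\<dots> = conv k g t"
    unfolding conv_def by (subst lborel_integral_real_affine[where c = "-1" and t = 0]) auto
  finally show ?thesis .
qed

section \<open>The fundamental matrix as a resolvent\<close>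

text \<open>The primitive of the measure A0 \<delta>_0 + A1 \<delta>_h + g(s) ds that drives the delay equation. Integrating
  the delay equation once turns it into the Volterra equation K = H + K * N for this kernel N.\<close>

definition volterra_kernel ::
    "real \<Rightarrow> real^'n^'n \<Rightarrow> real^'n^'n \<Rightarrow> (real \<Rightarrow> real^'n^'n) \<Rightarrow> real \<Rightarrow> real^'n^'n" where
  "volterra_kernel h A0 A1 g t = heaviside t ** A0 + heaviside (t - h) ** A1 + conv heaviside g t"

lemma transpose_heaviside: "transpose (heaviside t) = heaviside t"
  by (simp add: heaviside_def transpose_0)

lemma transpose_add: "transpose (X + Y) = transpose X + transpose (Y :: real^'n^'m)"
  by (simp add: transpose_def vec_eq_iff)

text \<open>The transposed kernel belongs to the delay system with transposed coefficients, so each statement about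
  the equation with coefficients on the right also yields one with coefficients on the left.\<close>

lemma transpose_volterra_kernel:
  "transpose (volterra_kernel h A0 A1 g t) =
    volterra_kernel h (transpose A0) (transpose A1) (\<lambda>s. transpose (g s)) t"
  using conv_transpose[of "\<lambda>t. g t" heaviside t]
  by (simp add: volterra_kernel_def transpose_add matrix_transpose_mul transpose_heaviside
      heaviside_commute conv_heaviside_commute)

lemma volterra_kernel_bounded:
  fixes G g :: "real \<Rightarrow> real^'n^'n"
  assumes g: "delay_kernel h G g" and h: "h > 0"
  shows "causal_bounded (volterra_kernel h A0 A1 g)" "\<exists>b. \<forall>t. norm (volterra_kernel h A0 A1 g t) \<le> b"
proof -
  note H = causal_bounded_heaviside and gi = delay_kernel_integrable[OF g h]
  have "h \<ge> 0" using h by simp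
  have mult: "causal_bounded (\<lambda>t. X t ** A)" if "causal_bounded X" for X :: "real \<Rightarrow> real^'n^'n" and A :: "real^'n^'n"
    by (rule causal_bounded_linear_image[OF that mm.bounded_linear_left])
  show "causal_bounded (volterra_kernel h A0 A1 g)"
    unfolding volterra_kernel_def[abs_def]
    by (rule causal_bounded_add[OF causal_bounded_add[OF mult[OF H] mult[OF causal_bounded_delay[OF H \<open>h \<ge> 0\<close>]]]
        conv_bounded[OF H gi]])
  obtain C where C: "C > 0" "\<And>(X :: real^'n^'n) (Y :: real^'n^'n). norm (X ** Y) \<le> C * (norm X * norm Y)"
    using matrix_mult_bound by metis
  define m where "m = norm (mat 1 :: real^'n^'n)"
  have m: "norm (heaviside s :: real^'n^'n) \<le> m" for s by (simp add: m_def heaviside_def)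
  have HA: "norm (heaviside s ** A) \<le> C * (m * norm A)" for s and A :: "real^'n^'n"
    using C(2)[of "heaviside s" A] mult_left_mono[OF mult_right_mono[OF m[of s] norm_ge_zero[of A]], of C] C(1)
    by linarith
  have "norm (volterra_kernel h A0 A1 g t) \<le> C * (m * norm A0) + C * (m * norm A1) + C * m * (\<integral>s. norm (g s) \<partial>lborel)" for t
    unfolding volterra_kernel_def
    using g C by (intro norm_triangle_mono HA norm_conv_le[OF H m gi]) (auto simp: delay_kernel_def)
  then show "\<exists>b. \<forall>t. norm (volterra_kernel h A0 A1 g t) \<le> b" by blast
qed

text \<open>The last identity is the integrated delay equation: integration, as convolution with the Heaviside
  function, is moved from K to the three delay terms by associativity and by shifting the
  integration variable.\<close>

lemma fundamental_rhs_conv: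
  fixes G g K :: "real \<Rightarrow> real^'n^'n"
  assumes K: "causal_bounded K" and G: "integrable (lebesgue_on {-h..0}) G"
    and g: "delay_kernel h G g" and h: "h > 0"
  shows "fundamental_rhs h A0 A1 G K t = K t ** A0 + K (t - h) ** A1 + conv K g t"
    "causal_bounded (fundamental_rhs h A0 A1 G K)"
    "conv (fundamental_rhs h A0 A1 G K) heaviside t = conv K (volterra_kernel h A0 A1 g) t"
proof -
  note i = causal_bounded_imp_integrable
  note H = causal_bounded_heaviside and gi = delay_kernel_integrable[OF g h]
  have h': "h \<ge> 0" using h by simp
  show rhs: "fundamental_rhs h A0 A1 G K t = K t ** A0 + K (t - h) ** A1 + conv K g t" for t
    by (simp add: fundamental_rhs_def delay_integral_eq_conv[OF G g causal_boundedD(1)[OF K]])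
  have b0: "causal_bounded (\<lambda>t. X t ** A)" if "causal_bounded X" for X :: "real \<Rightarrow> real^'n^'n" and A :: "real^'n^'n"
    by (rule causal_bounded_linear_image[OF that mm.bounded_linear_left])
  note b1 = b0[OF causal_bounded_delay[OF K h']]
  note b2 = conv_bounded[OF K gi]
  show "causal_bounded (fundamental_rhs h A0 A1 G K)"
    unfolding rhs[abs_def] by (rule causal_bounded_add[OF causal_bounded_add[OF b0[OF K] b1] b2])
  have "conv (fundamental_rhs h A0 A1 G K) heaviside t =
      conv (\<lambda>t. K t ** A0) heaviside t + conv (\<lambda>t. K (t - h) ** A1) heaviside t + conv (conv K g) heaviside t"
    unfolding rhs[abs_def]
    by (simp add: conv_add_left[OF causal_bounded_add[OF b0[OF K] b1] b2 i[OF H]] conv_add_left[OF b0[OF K] b1 i[OF H]])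
  also have "conv (\<lambda>t. K t ** A0) heaviside t = conv K (\<lambda>t. heaviside t ** A0) t"
    by (simp add: conv_def matrix_mul_assoc[symmetric] heaviside_commute)
  also have "conv (\<lambda>t. K (t - h) ** A1) heaviside t = conv K (\<lambda>t. heaviside (t - h) ** A1) t"
  proof -
    have "conv K (\<lambda>t. heaviside (t - h) ** A1) t = (\<integral>s. K (t - (h + 1 * s)) ** (heaviside (h + 1 * s - h) ** A1) \<partial>lborel)"
      unfolding conv_def by (subst lborel_integral_real_affine[where c = 1 and t = h]) auto
    then show ?thesis
      by (simp add: conv_def matrix_mul_assoc[symmetric] heaviside_commute algebra_simps)
  qed
  also have "conv (conv K g) heaviside t = conv K (conv heaviside g) t"
    using conv_assoc[OF K gi H, of t] by (simp add: conv_heaviside_commute[abs_def])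
  also have "conv K (\<lambda>t. heaviside t ** A0) t + conv K (\<lambda>t. heaviside (t - h) ** A1) t + conv K (conv heaviside g) t
      = conv K (volterra_kernel h A0 A1 g) t"
  proof -
    note c0 = b0[OF H, of A0] and c1 = b0[OF causal_bounded_delay[OF H h'], of A1]
    note c2 = conv_bounded[OF H gi]
    show ?thesis
      unfolding volterra_kernel_def[abs_def]
      by (simp add: conv_add_right[OF K i[OF causal_bounded_add[OF c0 c1]] i[OF c2]] conv_add_right[OF K i[OF c0] i[OF c1]])
  qed
  finally show "conv (fundamental_rhs h A0 A1 G K) heaviside t = conv K (volterra_kernel h A0 A1 g) t" .
qed

text \<open>The fundamental theorem of calculus applies separately on [0, h] and on [h, t], because at h only the
  one-sided derivatives of K exist.\<close>

lemma fundamental_matrix_imp_volterra: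
  assumes G: "integrable (lebesgue_on {-h..0}) G" and g: "delay_kernel h G g" and h: "h > 0"
    and K: "fundamental_matrix h A0 A1 G K"
  shows "causal_bounded K" "continuous_on {0..} K"
    "K t = heaviside t + conv K (volterra_kernel h A0 A1 g) t"
proof -
  let ?F = "fundamental_rhs h A0 A1 G K"
  show cont: "continuous_on {0..} K" using K by (simp add: fundamental_matrix_def)
  show Kb: "causal_bounded K"
    by (rule causal_bounded_continuous[OF cont]) (use K in \<open>auto simp: fundamental_matrix_def\<close>)
  note F = fundamental_rhs_conv[OF Kb G g h, of A0 A1]
  have D1: "(K has_vector_derivative ?F t) (at t)" if "0 < t" "t < h" for t
  proof -
    have "(K has_vector_derivative ?F t) (at t within {0..<h})"
      using K that by (auto simp: fundamental_matrix_def)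
    moreover have "at t within {0..<h} = at t"
      using that by (intro at_within_nhd[of t "{0<..<h}"]) auto
    ultimately show ?thesis by simp
  qed
  have D2: "(K has_vector_derivative ?F t) (at t)" if "h < t" for t
  proof -
    have "(K has_vector_derivative ?F t) (at t within {h..})"
      using K that by (auto simp: fundamental_matrix_def)
    moreover have "at t within {h..} = at t"
      using that by (intro at_within_nhd[of t "{h<..}"]) auto
    ultimately show ?thesis by simp
  qed
  have I1: "(?F has_integral (K t - K 0)) {0..t}" if "0 \<le> t" "t \<le> h" for t
    by (rule fundamental_theorem_of_calculus_interior[OF that(1) continuous_on_subset[OF cont] D1]) (use that in auto)
  have I2: "(?F has_integral (K t - K h)) {h..t}" if "h \<le> t" for t
    by (rule fundamental_theorem_of_calculus_interior[OF that(1) continuous_on_subset[OF cont] D2]) (use that h in auto)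
  have I: "(?F has_integral (K t - K 0)) {0..t}" if "0 \<le> t" for t
  proof (cases "t \<le> h")
    case False
    then show ?thesis
      using has_integral_combine[OF _ _ I1[of h] I2[of t]] h by auto
  qed (use I1 that in auto)
  show "K t = heaviside t + conv K (volterra_kernel h A0 A1 g) t"
  proof (cases "t < 0")
    case True
    then show ?thesis
      using causal_boundedD(2)[OF Kb] conv_negative[OF Kb causal_bounded_imp_integrable[OF volterra_kernel_bounded(1)[OF g h]]]
      by (simp add: heaviside_def)
  next
    case False
    have "conv K (volterra_kernel h A0 A1 g) t = K t - K 0"
      using False I[of t] by (simp add: F(3)[symmetric] conv_heaviside_eq_integral[OF F(2)] integral_unique)
    then show ?thesis using False K by (simp add: heaviside_def fundamental_matrix_def)
  qed
qed

text \<open>The right-hand side of the delay equation is continuous on [0, h) and on [h, \<infinity>), and it jumps at h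
  together with K(t - h). Differentiating its primitive on each piece gives exactly the one-sided
  derivatives demanded of a fundamental matrix.\<close>

lemma volterra_imp_fundamental_matrix:
  fixes K :: "real \<Rightarrow> real^'n^'n"
  assumes G: "integrable (lebesgue_on {-h..0}) G" and g: "delay_kernel h G g" and h: "h > 0"
    and K: "causal_bounded K" "continuous_on {0..} K"
      "\<And>t. K t = heaviside t + conv K (volterra_kernel h A0 A1 g) t"
  shows "fundamental_matrix h A0 A1 G K"
proof -
  let ?F = "fundamental_rhs h A0 A1 G K"
  note F = fundamental_rhs_conv[OF K(1) G g h, of A0 A1]
  have eq: "K t = mat 1 + integral {0..t} ?F" if "t \<ge> 0" for t
    using K(3)[of t] that by (simp add: F(3)[symmetric] conv_heaviside_eq_integral[OF F(2)] heaviside_def)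
  have conv_cont: "continuous_on S (conv K g)" for S
    by (rule continuous_on_subset[OF conv_continuous[OF K(1,2) delay_kernel_integrable[OF g h]]]) simp
  have shift_early: "continuous_on {0..<h} (\<lambda>t. K (t - h))"
    by (rule continuous_on_eq[of _ "\<lambda>_. 0"]) (use causal_boundedD(2)[OF K(1)] in auto)
  have shift_late: "continuous_on {h..} (\<lambda>t. K (t - h))"
    by (intro continuous_on_compose2[OF K(2)] continuous_intros) auto
  have sum_cont: "continuous_on S ?F" if "S \<subseteq> {0..}" "continuous_on S (\<lambda>t. K (t - h))" for S
  proof (rule continuous_on_eq)
    show "continuous_on S (\<lambda>t. K t ** A0 + K (t - h) ** A1 + conv K g t)"
      by (rule continuous_on_add[OF continuous_on_add[OF mm.continuous_on mm.continuous_on] conv_cont]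
          continuous_on_subset[OF K(2) that(1)] that(2) continuous_on_const)+
  qed (simp add: F(1))
  have F_early: "continuous_on {0..<h} ?F"
    using shift_early by (rule sum_cont[rotated]) auto
  have F_late: "continuous_on {h..} ?F"
    using shift_late by (rule sum_cont[rotated]) (use h in auto)
  have D: "(K has_vector_derivative ?F t) (at t within {a..b})"
    if ab: "0 \<le> a" "t \<in> {a..b}" "continuous_on {a..b} ?F" for a b t
  proof -
    have int: "?F integrable_on {0..u}" for u
    proof (cases "u \<ge> 0")
      case True
      have "integrable lborel (\<lambda>s. indicator {..u} s *\<^sub>R ?F s)"
        by (rule causal_integrableD(3)[OF causal_bounded_imp_integrable[OF F(2)]])
      moreover have "indicator {..u} s *\<^sub>R ?F s = indicator {0..u} s *\<^sub>R ?F s" for s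
        using causal_boundedD(2)[OF F(2)] by (auto simp: indicator_def not_le)
      ultimately have "set_integrable lborel {0..u} ?F"
        by (simp add: set_integrable_def)
      then show ?thesis by (rule set_borel_integral_eq_integral(1))
    qed (simp add: integrable_on_empty)
    \<comment> \<open>The integral starts at a and not at 0, since the integrand is continuous only on [a, b].\<close>
    have "((\<lambda>u. (mat 1 + integral {0..a} ?F) + integral {a..u} ?F) has_vector_derivative 0 + ?F t) (at t within {a..b})"
      by (intro has_vector_derivative_add has_vector_derivative_const integral_has_vector_derivative ab)
    then have *: "((\<lambda>u. (mat 1 + integral {0..a} ?F) + integral {a..u} ?F) has_vector_derivative ?F t) (at t within {a..b})"
      by simp
    show ?thesis
    proof (rule has_vector_derivative_transform[OF ab(2) _ *])
      fix u assume u: "u \<in> {a..b}"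
      then have "integral {0..a} ?F + integral {a..u} ?F = integral {0..u} ?F"
        using ab int by (intro Henstock_Kurzweil_Integration.integral_combine) auto
      then show "K u = (mat 1 + integral {0..a} ?F) + integral {a..u} ?F"
        using eq[of u] u ab by (simp add: add.assoc)
    qed
  qed
  have "(K has_vector_derivative ?F t) (at t within {0..<h})" if t: "t \<in> {0..<h}" for t
  proof -
    define b where "b = (t + h) / 2"
    have b: "t < b" "b < h" using t by (auto simp: b_def)
    have "(K has_vector_derivative ?F t) (at t within {0..b})"
      using t b by (intro D continuous_on_subset[OF F_early]) auto
    moreover have "at t within {0..b} = at t within {0..<h}"
      using b by (intro at_within_nhd[of t "{..<b}"]) auto
    ultimately show ?thesis by simp
  qed
  moreover have "(K has_vector_derivative ?F t) (at t within {h..})" if t: "t \<in> {h..}" for t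
  proof -
    have "(K has_vector_derivative ?F t) (at t within {h..t+1})"
      using t h by (intro D continuous_on_subset[OF F_late]) auto
    moreover have "at t within {h..t+1} = at t within {h..}"
      by (intro at_within_nhd[of t "{..<t+1}"]) auto
    ultimately show ?thesis by simp
  qed
  moreover have "K 0 = mat 1" using eq[of 0] by simp
  ultimately show ?thesis
    using K(2) causal_boundedD(2)[OF K(1)] by (simp add: fundamental_matrix_def)
qed

lemma integrable_transpose:
  assumes "integrable M (G :: real \<Rightarrow> real^'n^'m)"
  shows "integrable M (\<lambda>\<theta>. transpose (G \<theta>))"
  by (rule integrable_bounded_linear[OF bounded_linear_transpose assms])

lemma fundamental_matrix_exists:
  assumes G: "integrable (lebesgue_on {-h..0}) G" and h: "h > 0"
  obtains K where "fundamental_matrix h A0 A1 G K"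
proof -
  obtain g where g: "delay_kernel h G g" using delay_kernel_exists[OF G] .
  obtain b where b: "\<And>t. norm (volterra_kernel h A0 A1 g t) \<le> b"
    using volterra_kernel_bounded(2)[OF g h] by blast
  obtain K where K: "continuous_on {0..} K" "\<And>t. t < 0 \<Longrightarrow> K t = 0"
    "\<And>t. K t = heaviside t + conv K (volterra_kernel h A0 A1 g) t"
    by (metis volterra_exists[OF volterra_kernel_bounded(1)[OF g h] b])
  show thesis
    by (rule that, rule volterra_imp_fundamental_matrix[OF G g h causal_bounded_continuous[OF K(1,2)] K(1,3)])
qed

text \<open>K is the right resolvent of the Volterra kernel N, and transposing the resolvent of the transposed
  kernel gives the left resolvent of N.\<close>

lemma fundamental_matrix_eq_transpose:
  assumes G: "integrable (lebesgue_on {-h..0}) G" and h: "h > 0"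
    and K: "fundamental_matrix h A0 A1 G K"
    and L: "fundamental_matrix h (transpose A0) (transpose A1) (\<lambda>\<theta>. transpose (G \<theta>)) L"
  shows "K = (\<lambda>t. transpose (L t))"
proof -
  obtain g where g: "delay_kernel h G g" using delay_kernel_exists[OF G] .
  let ?N = "volterra_kernel h A0 A1 g"
  note VK = fundamental_matrix_imp_volterra[OF G g h K]
  note VL = fundamental_matrix_imp_volterra[OF integrable_transpose[OF G] delay_kernel_transpose[OF g] h L]
  have eq: "transpose (L t) = heaviside t + conv ?N (\<lambda>t. transpose (L t)) t" for t
  proof -
    have "conv ?N (\<lambda>t. transpose (L t)) t = transpose (conv L (\<lambda>t. transpose (?N t)) t)"
      using conv_transpose[of "\<lambda>t. transpose (?N t)" L t] by simp
    then show ?thesis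
      using arg_cong[OF VL(3)[of t], of transpose]
      by (simp only: transpose_add transpose_heaviside transpose_volterra_kernel)
  qed
  have cont: "continuous_on {0..} (\<lambda>t. transpose (L t))"
    by (rule bounded_linear.continuous_on[OF bounded_linear_transpose VL(2)])
  show ?thesis
    by (rule resolvent_left_eq_right[OF volterra_kernel_bounded(1)[OF g h] VK causal_transpose(1)[OF VL(1)] cont eq])
qed

lemma fundamental_matrix_unique:
  assumes G: "integrable (lebesgue_on {-h..0}) G" and h: "h > 0"
    and "fundamental_matrix h A0 A1 G K" "fundamental_matrix h A0 A1 G K'"
  shows "K = K'"
proof -
  obtain L where L: "fundamental_matrix h (transpose A0) (transpose A1) (\<lambda>\<theta>. transpose (G \<theta>)) L"
    using fundamental_matrix_exists[OF integrable_transpose[OF G] h] .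
  show ?thesis
    using fundamental_matrix_eq_transpose[OF G h assms(3) L] fundamental_matrix_eq_transpose[OF G h assms(4) L] by simp
qed

text \<open>Equivalently, K also satisfies the equation with the coefficients on its left,
  K'(t) = A0 K(t) + A1 K(t - h) + \<integral> G(\<theta>) K(t + \<theta>) d\<theta>; so the columns of K solve the delay system itself.
  Stability is a statement about the solutions of that system.\<close>

lemma fundamental_matrix_transpose:
  assumes G: "integrable (lebesgue_on {-h..0}) G" and h: "h > 0"
    and K: "fundamental_matrix h A0 A1 G K"
  shows "fundamental_matrix h (transpose A0) (transpose A1) (\<lambda>\<theta>. transpose (G \<theta>)) (\<lambda>t. transpose (K t))"
proof -
  obtain L where L: "fundamental_matrix h (transpose A0) (transpose A1) (\<lambda>\<theta>. transpose (G \<theta>)) L"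
    using fundamental_matrix_exists[OF integrable_transpose[OF G] h] .
  show ?thesis
    using fundamental_matrix_eq_transpose[OF G h K L] L by simp
qed

section \<open>Exponential decay of the fundamental matrix\<close>

lemma borel_measurable_bounded_bilinear:
  fixes f :: "'x \<Rightarrow> 'a::euclidean_space" and g :: "'x \<Rightarrow> 'b::euclidean_space"
    and \<beta> :: "'a \<Rightarrow> 'b \<Rightarrow> 'c::euclidean_space"
  assumes "f \<in> borel_measurable M" "g \<in> borel_measurable M" and \<beta>: "bounded_bilinear \<beta>"
  shows "(\<lambda>x. \<beta> (f x) (g x)) \<in> borel_measurable M"
  using assms(1,2)
  by (rule borel_measurable_continuous_Pair)
    (intro bounded_bilinear.continuous_on[OF \<beta>] continuous_on_fst continuous_on_snd continuous_on_id)

lemma integrable_bilinear_bounded: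
  fixes f :: "'x \<Rightarrow> 'a::euclidean_space" and g :: "'x \<Rightarrow> 'b::euclidean_space"
    and \<beta> :: "'a \<Rightarrow> 'b \<Rightarrow> 'c::euclidean_space"
  assumes \<beta>: "bounded_bilinear \<beta>" and f: "f \<in> borel_measurable M" and bound: "\<And>x. x \<in> space M \<Longrightarrow> norm (f x) \<le> B"
    and g: "integrable M g"
  shows "integrable M (\<lambda>x. \<beta> (f x) (g x))"
proof -
  obtain C where C: "C > 0" "\<And>a b. norm (\<beta> a b) \<le> norm a * norm b * C"
    using bounded_bilinear.pos_bounded[OF \<beta>] by blast
  show ?thesis
  proof (rule Bochner_Integration.integrable_bound)
    show "integrable M (\<lambda>x. (C * B) *\<^sub>R g x)" using g by auto
    show "(\<lambda>x. \<beta> (f x) (g x)) \<in> borel_measurable M"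
      using f borel_measurable_integrable[OF g] \<beta>
      by (rule borel_measurable_bounded_bilinear)
    show "AE x in M. norm (\<beta> (f x) (g x)) \<le> norm ((C * B) *\<^sub>R g x)"
    proof (rule AE_I2)
      fix x assume x: "x \<in> space M"
      have "norm (\<beta> (f x) (g x)) \<le> norm (f x) * norm (g x) * C" by (rule C)
      also have "\<dots> \<le> B * norm (g x) * C"
        using C bound[OF x] by (intro mult_right_mono) auto
      also have "\<dots> \<le> norm ((C * B) *\<^sub>R g x)"
        using C(1) mult_right_mono[OF abs_ge_self[of B], of "norm (g x) * C"] by (simp add: abs_mult mult_ac)
      finally show "norm (\<beta> (f x) (g x)) \<le> norm ((C * B) *\<^sub>R g x)" .
    qed
  qed
qed

lemma borel_imp_lebesgue_on:
  "f \<in> borel_measurable borel \<Longrightarrow> f \<in> borel_measurable (lebesgue_on S)"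
  by (intro measurable_restrict_space1 measurable_completion) simp

lemma norm_matrix_le_columns:
  obtains c where "c \<ge> 0" "\<And>X :: real^'n^'n. norm X \<le> c * (\<Sum>j\<in>UNIV. norm (X *v axis j 1))"
proof -
  obtain c where c: "c \<ge> 0" "\<And>X :: real^'n^'n. norm (transpose X) \<le> norm X * c"
    using bounded_linear.nonneg_bounded[OF bounded_linear_transpose] by blast
  have "norm X \<le> c * (\<Sum>j\<in>UNIV. norm (X *v axis j 1))" for X :: "real^'n^'n"
  proof -
    have "transpose X $ j = X *v axis j 1" for j
      by (simp add: matrix_vector_mult_basis column_def transpose_def)
    then have "norm (transpose X) \<le> (\<Sum>j\<in>UNIV. norm (X *v axis j 1))"
      unfolding norm_vec_def[of "transpose X"] using L2_set_le_sum[of UNIV "\<lambda>j. norm (transpose X $ j)"] by simp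
    moreover have "norm X \<le> norm (transpose X) * c" using c(2)[of "transpose X"] by simp
    ultimately show ?thesis using c(1) mult_left_mono by (fastforce simp: mult.commute)
  qed
  with c(1) show thesis by (rule that)
qed

text \<open>The columns of K have a jump at time 0, but stability speaks of continuous initial functions only. After a
  shift by h the history of the column lies in [0, h], where K is continuous.\<close>

lemma fundamental_matrix_column_solution:
  fixes G K :: "real \<Rightarrow> real^'n^'n"
    and v :: "real^'n"
  assumes G: "integrable (lebesgue_on {-h..0}) G" and h: "h > 0"
    and K: "fundamental_matrix h A0 A1 G K"
  defines "x \<equiv> \<lambda>t. K (t + h) *v v"
  shows "continuous_on {-h..} x" "solution h A0 A1 G x x"
proof -
  have mv: "bounded_linear (\<lambda>X :: real^'n^'n. X *v v)"
    unfolding linear_conv_bounded_linear[symmetric]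
    by (auto intro!: linearI simp: matrix_vector_mult_add_rdistrib scaleR_matrix_vector_assoc)
  obtain g where g: "delay_kernel h G g" using delay_kernel_exists[OF G] .
  note VK = fundamental_matrix_imp_volterra[OF G g h K]
  show cont: "continuous_on {-h..} x"
    unfolding x_def
    by (intro bounded_linear.continuous_on[OF mv] continuous_on_compose2[OF VK(2)] continuous_intros) auto
  \<comment> \<open>The transpose of K satisfies the delay equation with transposed coefficients; x is its image under L, shifted by h.\<close>
  define KT where "KT t = transpose (K t)" for t
  have KT: "fundamental_matrix h (transpose A0) (transpose A1) (\<lambda>\<theta>. transpose (G \<theta>)) KT"
    unfolding KT_def[abs_def] by (rule fundamental_matrix_transpose[OF G h K])
  have KTb: "causal_bounded KT" unfolding KT_def[abs_def] by (rule causal_transpose(1)[OF VK(1)])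
  define L where "L X = transpose X *v v" for X :: "real^'n^'n"
  have L: "bounded_linear L"
    unfolding L_def[abs_def] by (rule bounded_linear_compose[OF mv bounded_linear_transpose])
  have x_eq: "x t = L (KT (t + h))" for t by (simp add: x_def L_def KT_def)
  have "(x has_vector_derivative
        (A0 *v x t + A1 *v x (t - h) + (LINT \<theta>|lebesgue_on {-h..0}. G \<theta> *v x (t + \<theta>))))
        (at t within {0..})" if t: "t \<ge> 0" for t
  proof -
    let ?R = "fundamental_rhs h (transpose A0) (transpose A1) (\<lambda>\<theta>. transpose (G \<theta>)) KT"
    have "(KT has_vector_derivative ?R (t + h)) (at (t + h) within {h..})"
      using KT t by (simp add: fundamental_matrix_def)
    moreover have "(\<lambda>s. s + h) ` {0..} = {h..}"
      by (auto intro!: image_eqI[of _ _ "s - h" for s])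
    ultimately have "(KT has_vector_derivative ?R (t + h)) (at ((\<lambda>s. s + h) t) within (\<lambda>s. s + h) ` {0..})"
      by simp
    moreover have "((\<lambda>s. s + h) has_vector_derivative 1) (at t within {0..})"
      by (auto intro!: derivative_eq_intros simp: has_real_derivative_iff_has_vector_derivative[symmetric])
    ultimately have "((KT \<circ> (\<lambda>s. s + h)) has_vector_derivative 1 *\<^sub>R ?R (t + h)) (at t within {0..})"
      by (intro vector_diff_chain_within)
    from bounded_linear.has_vector_derivative[OF L this]
    have D: "(x has_vector_derivative L (?R (t + h))) (at t within {0..})"
      by (simp add: x_eq[abs_def] o_def)
    obtain B where B: "B \<ge> 0" "\<And>s. s \<le> t + h \<Longrightarrow> norm (KT s) \<le> B"
      using causal_bounded_bound[OF KTb] by blast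
    have meas: "(\<lambda>\<theta>. KT (t + h + \<theta>)) \<in> borel_measurable (lebesgue_on {-h..0})"
    proof (rule borel_imp_lebesgue_on)
      note [measurable] = causal_boundedD(1)[OF KTb]
      show "(\<lambda>\<theta>. KT (t + h + \<theta>)) \<in> borel_measurable borel" by measurable
    qed
    have "integrable (lebesgue_on {-h..0}) (\<lambda>\<theta>. KT (t + h + \<theta>) ** transpose (G \<theta>))"
      by (rule integrable_bilinear_bounded[OF bounded_bilinear_matrix_mult meas _ integrable_transpose[OF G], where B = B])
        (use B(2) in auto)
    from integral_bounded_linear[OF L this]
    have "L (LINT \<theta>|lebesgue_on {-h..0}. KT (t + h + \<theta>) ** transpose (G \<theta>)) =
        (LINT \<theta>|lebesgue_on {-h..0}. L (KT (t + h + \<theta>) ** transpose (G \<theta>)))" by simp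
    also have "\<dots> = (LINT \<theta>|lebesgue_on {-h..0}. G \<theta> *v x (t + \<theta>))"
      by (simp add: L_def KT_def x_def matrix_transpose_mul matrix_vector_mul_assoc add_ac)
    finally have I: "L (LINT \<theta>|lebesgue_on {-h..0}. KT (t + h + \<theta>) ** transpose (G \<theta>)) =
        (LINT \<theta>|lebesgue_on {-h..0}. G \<theta> *v x (t + \<theta>))" .
    have L_add: "L (X + Y) = L X + L Y" for X Y
      by (rule linear_add[OF bounded_linear.linear[OF L]])
    have "L (?R (t + h)) = A0 *v x t + A1 *v x (t - h) + (LINT \<theta>|lebesgue_on {-h..0}. G \<theta> *v x (t + \<theta>))"
      unfolding fundamental_rhs_def L_add I
      by (simp add: L_def KT_def x_def matrix_transpose_mul matrix_vector_mul_assoc)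
    with D show ?thesis by simp
  qed
  with cont show "solution h A0 A1 G x x" by (auto simp: solution_def)
qed

text \<open>The stability estimate for the shifted columns bounds K on [h, \<infinity>); on [0, h] the matrix K is bounded by
  continuity, and the factor exp(\<sigma> h) absorbs both the shift and this initial interval.\<close>

lemma fundamental_matrix_decay:
  fixes G K :: "real \<Rightarrow> real^'n^'n"
  assumes G: "integrable (lebesgue_on {-h..0}) G" and h: "h > 0"
    and K: "fundamental_matrix h A0 A1 G K" and stable: "exponentially_stable h A0 A1 G"
  obtains C \<sigma> where "C \<ge> 0" "\<sigma> > 0" "\<And>t. norm (K t) \<le> C * exp (- \<sigma> * t)"
proof -
  obtain g where g: "delay_kernel h G g" using delay_kernel_exists[OF G] .
  note VK = fundamental_matrix_imp_volterra[OF G g h K]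
  obtain \<gamma> \<sigma> where \<sigma>: "\<sigma> > 0" and st: "\<And>\<phi> x t. continuous_on {-h..0} \<phi> \<Longrightarrow> solution h A0 A1 G \<phi> x \<Longrightarrow> t \<ge> 0 \<Longrightarrow>
      norm (x t) \<le> \<gamma> * exp (- \<sigma> * t) * (SUP \<theta>\<in>{-h..0}. norm (\<phi> \<theta>))"
    using stable unfolding exponentially_stable_def by blast
  define c where "c j = \<gamma> * (SUP \<theta>\<in>{-h..0}. norm (K (\<theta> + h) *v axis j 1))" for j
  have column: "norm (K (t + h) *v axis j 1) \<le> c j * exp (- \<sigma> * t)" if "t \<ge> 0" for t j
  proof -
    note s = fundamental_matrix_column_solution[OF G h K, of "axis j 1"]
    show ?thesis
      using st[OF continuous_on_subset[OF s(1)] s(2) that] by (simp add: c_def mult_ac)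
  qed
  obtain d where d: "d \<ge> 0" "\<And>X :: real^'n^'n. norm X \<le> d * (\<Sum>j\<in>UNIV. norm (X *v axis j 1))"
    using norm_matrix_le_columns by blast
  obtain B where B: "B \<ge> 0" "\<And>s. s \<le> h \<Longrightarrow> norm (K s) \<le> B"
    using causal_bounded_bound[OF VK(1)] by blast
  define s where "s = d * (\<Sum>j\<in>UNIV. \<bar>c j\<bar>)"
  have s0: "s \<ge> 0" unfolding s_def using d(1) by (simp add: sum_nonneg)
  have "norm (K t) \<le> ((B + s) * exp (\<sigma> * h)) * exp (- \<sigma> * t)" for t
  proof (cases "t \<le> h")
    case True
    have "norm (K t) \<le> (B + s) * 1" using B(2)[OF True] s0 by simp
    also have "\<dots> \<le> (B + s) * exp (\<sigma> * (h - t))"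
      using True \<sigma> B(1) s0 by (intro mult_left_mono) auto
    finally show ?thesis by (simp add: exp_add[symmetric] algebra_simps)
  next
    case False
    have "norm (K t) \<le> d * (\<Sum>j\<in>UNIV. norm (K t *v axis j 1))" by (rule d(2))
    also have "\<dots> \<le> d * (\<Sum>j\<in>UNIV. \<bar>c j\<bar> * exp (- \<sigma> * (t - h)))"
    proof (intro mult_left_mono[OF _ d(1)] sum_mono)
      fix j
      have "norm (K t *v axis j 1) \<le> c j * exp (- \<sigma> * (t - h))"
        using column[of "t - h" j] False by simp
      also have "\<dots> \<le> \<bar>c j\<bar> * exp (- \<sigma> * (t - h))" by (intro mult_right_mono) auto
      finally show "norm (K t *v axis j 1) \<le> \<bar>c j\<bar> * exp (- \<sigma> * (t - h))" .
    qed
    also have "\<dots> = s * exp (- \<sigma> * (t - h))" by (simp add: s_def sum_distrib_right mult.assoc)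
    also have "\<dots> \<le> (B + s) * exp (- \<sigma> * (t - h))" using B(1) by (intro mult_right_mono) auto
    finally show ?thesis by (simp add: exp_add[symmetric] algebra_simps)
  qed
  then show thesis using \<sigma> B(1) s0 by (intro that[of "(B + s) * exp (\<sigma> * h)" \<sigma>]) auto
qed

section \<open>Kernels that are continuous in the shift and linear in the matrix\<close>

text \<open>The map U(\<tau>, M) has these properties, and integrating such a map against integrable weights, either
  outside of the map or inside its matrix argument, produces another one. Hence every iterated integral
  can be built from the innermost one outwards, without proving measurability of the intermediate
  integrals separately.\<close>

definition kernel_operator ::
    "(real \<Rightarrow> 'm::euclidean_space \<Rightarrow> 'v::euclidean_space) \<Rightarrow> bool" where
  "kernel_operator W \<longleftrightarrow> (\<forall>M. continuous_on UNIV (\<lambda>\<tau>. W \<tau> M)) \<and> (\<forall>\<tau>. linear (W \<tau>)) \<and>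
     (\<exists>B. \<forall>\<tau> M. norm (W \<tau> M) \<le> B * norm M)"

lemma kernel_operator_bound:
  assumes "kernel_operator W"
  obtains B where "B \<ge> 0" "\<And>\<tau> M. norm (W \<tau> M) \<le> B * norm M"
proof -
  obtain B where B: "\<And>\<tau> M. norm (W \<tau> M) \<le> B * norm M"
    using assms by (auto simp: kernel_operator_def)
  have "norm (W \<tau> M) \<le> max B 0 * norm M" for \<tau> M
    using order_trans[OF B mult_right_mono[of B "max B 0" "norm M"]] by simp
  then show thesis by (intro that[of "max B 0"]) auto
qed

lemma kernel_operator_jointly_continuous:
  assumes W: "kernel_operator W"
  shows "continuous_on UNIV (\<lambda>p. W (fst p) (snd p))"
proof (intro continuous_at_imp_continuous_on ballI)
  fix p :: "real \<times> 'a"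
  obtain B where B: "B \<ge> 0" "\<And>\<tau> M. norm (W \<tau> M) \<le> B * norm M"
    using kernel_operator_bound[OF W] by blast
  have "((\<lambda>q. W (fst q) (snd q - snd p)) \<longlongrightarrow> 0) (at p)"
  proof (rule Lim_null_comparison)
    show "eventually (\<lambda>q. norm (W (fst q) (snd q - snd p)) \<le> B * norm (snd q - snd p)) (at p)"
      using B(2) by simp
    have "((\<lambda>q. B * norm (snd q - snd p)) \<longlongrightarrow> B * norm (snd p - snd p)) (at p)"
      by (intro tendsto_intros)
    then show "((\<lambda>q. B * norm (snd q - snd p)) \<longlongrightarrow> 0) (at p)" by simp
  qed
  moreover have "((\<lambda>q. W (fst q) (snd p)) \<longlongrightarrow> W (fst p) (snd p)) (at p)"
  proof (rule isCont_tendsto_compose[where g = "\<lambda>\<tau>. W \<tau> (snd p)" and f = fst])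
    show "isCont (\<lambda>\<tau>. W \<tau> (snd p)) (fst p)"
      using W by (auto simp: kernel_operator_def continuous_on_eq_continuous_at)
  qed (intro tendsto_intros)
  ultimately have "((\<lambda>q. W (fst q) (snd q - snd p) + W (fst q) (snd p)) \<longlongrightarrow> 0 + W (fst p) (snd p)) (at p)"
    by (rule tendsto_add)
  moreover have "W \<tau> (M - M') + W \<tau> M' = W \<tau> M" for \<tau> M M'
    using W linear_diff[of "W \<tau>" M M'] by (simp add: kernel_operator_def)
  ultimately show "isCont (\<lambda>p. W (fst p) (snd p)) p"
    by (simp add: isCont_def)
qed

lemma kernel_operator_measurable:
  assumes W: "kernel_operator W" and "a \<in> borel_measurable M" "b \<in> borel_measurable M"
  shows "(\<lambda>x. W (a x) (b x)) \<in> borel_measurable M"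
  using borel_measurable_continuous_Pair[OF assms(2,3) kernel_operator_jointly_continuous[OF W]] by simp

text \<open>Dominated convergence gives continuity in the shift. As in the case of U itself, the integrand may be
  discontinuous at a given shift for a null set of integration variables.\<close>

lemma kernel_operator_integral:
  fixes \<Phi> :: "real \<Rightarrow> real \<Rightarrow> 'm::euclidean_space \<Rightarrow> 'v::euclidean_space"
  assumes meas: "\<And>\<tau> M. (\<lambda>\<delta>. \<Phi> \<tau> \<delta> M) \<in> borel_measurable (lebesgue_on S)"
    and cont: "\<And>\<tau> M. AE \<delta> in lebesgue_on S. isCont (\<lambda>\<tau>. \<Phi> \<tau> \<delta> M) \<tau>"
    and lin: "\<And>\<tau> \<delta>. linear (\<Phi> \<tau> \<delta>)"
    and bound: "\<And>\<tau> \<delta> M. norm (\<Phi> \<tau> \<delta> M) \<le> w \<delta> * norm M"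
    and w: "integrable (lebesgue_on S) w"
  obtains V where "kernel_operator V" "\<And>\<tau> M. has_iint1 S (\<lambda>\<delta>. \<Phi> \<tau> \<delta> M) (V \<tau> M)"
proof -
  define V where "V \<tau> M = (LINT \<delta>|lebesgue_on S. \<Phi> \<tau> \<delta> M)" for \<tau> M
  have wM: "integrable (lebesgue_on S) (\<lambda>\<delta>. w \<delta> * norm M)" for M :: 'm using w by auto
  have int: "integrable (lebesgue_on S) (\<lambda>\<delta>. \<Phi> \<tau> \<delta> M)" for \<tau> M
    by (rule Bochner_Integration.integrable_bound[OF wM[of M] meas])
      (intro AE_I2, use bound in \<open>auto intro: order_trans[OF _ abs_ge_self]\<close>)
  have "kernel_operator V"
    unfolding kernel_operator_def
  proof (intro conjI allI)
    fix M
    show "continuous_on UNIV (\<lambda>\<tau>. V \<tau> M)"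
      unfolding V_def
    proof (intro continuous_at_imp_continuous_on ballI isCont_integral_dominated[OF meas wM[of M]])
      show "AE \<delta> in lebesgue_on S. norm (\<Phi> \<tau> \<delta> M) \<le> w \<delta> * norm M" for \<tau> using bound by simp
      show "AE \<delta> in lebesgue_on S. isCont (\<lambda>\<tau>. \<Phi> \<tau> \<delta> M) \<tau>" for \<tau>
        by (rule cont)
    qed
  next
    fix \<tau>
    show "linear (V \<tau>)"
      using int by (intro linearI) (simp_all add: V_def linear_add[OF lin] linear_scale[OF lin])
  next
    have "norm (V \<tau> M) \<le> (LINT \<delta>|lebesgue_on S. w \<delta>) * norm M" for \<tau> M
    proof -
      have "norm (V \<tau> M) \<le> (LINT \<delta>|lebesgue_on S. w \<delta> * norm M)"
        unfolding V_def by (rule Bochner_Integration.integral_norm_bound_integral[OF int wM bound])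
      then show ?thesis by simp
    qed
    then show "\<exists>B. \<forall>\<tau> M. norm (V \<tau> M) \<le> B * norm M" by blast
  qed
  moreover have "has_iint1 S (\<lambda>\<delta>. \<Phi> \<tau> \<delta> M) (V \<tau> M)" for \<tau> M
    unfolding has_iint1_def V_def by (rule has_bochner_integral_integrable[OF int])
  ultimately show thesis by (rule that)
qed

lemma kernel_operator_integral_outside:
  fixes \<beta> :: "'v::euclidean_space \<Rightarrow> 'g::euclidean_space \<Rightarrow> 'u::euclidean_space"
  assumes W: "kernel_operator W" and \<beta>: "bounded_bilinear \<beta>" and g: "integrable (lebesgue_on S) g"
  obtains V where "kernel_operator V"
    "\<And>\<tau> M. has_iint1 S (\<lambda>\<delta>. \<beta> (W (\<tau> + s * \<delta>) M) (g \<delta>)) (V \<tau> M)"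
proof -
  obtain B where B: "B \<ge> 0" "\<And>\<tau> M. norm (W \<tau> M) \<le> B * norm M"
    using kernel_operator_bound[OF W] by blast
  obtain C where C: "C > 0" "\<And>a b. norm (\<beta> a b) \<le> norm a * norm b * C"
    using bounded_bilinear.pos_bounded[OF \<beta>] by blast
  have Wc: "isCont (\<lambda>\<tau>. W \<tau> M) \<tau>" and Wl: "linear (W \<tau>)" for M \<tau>
    using W by (auto simp: kernel_operator_def continuous_on_eq_continuous_at)
  show thesis
  proof (rule kernel_operator_integral[of "\<lambda>\<tau> \<delta> M. \<beta> (W (\<tau> + s * \<delta>) M) (g \<delta>)" S "\<lambda>\<delta>. C * B * norm (g \<delta>)"])
    show "(\<lambda>\<delta>. \<beta> (W (\<tau> + s * \<delta>) M) (g \<delta>)) \<in> borel_measurable (lebesgue_on S)" for \<tau> M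
      by (intro borel_measurable_bounded_bilinear[OF _ borel_measurable_integrable[OF g] \<beta>]
          kernel_operator_measurable[OF W] borel_imp_lebesgue_on borel_measurable_const) measurable
    show "AE \<delta> in lebesgue_on S. isCont (\<lambda>\<tau>. \<beta> (W (\<tau> + s * \<delta>) M) (g \<delta>)) \<tau>" for \<tau> M
      by (intro AE_I2 bounded_bilinear.continuous[OF \<beta>] continuous_const isCont_o2[OF _ Wc] continuous_intros)
    show "linear (\<lambda>M. \<beta> (W (\<tau> + s * \<delta>) M) (g \<delta>))" for \<tau> \<delta>
      by (intro linearI) (simp_all add: linear_add[OF Wl] linear_scale[OF Wl]
          bounded_bilinear.add_left[OF \<beta>] bounded_bilinear.scaleR_left[OF \<beta>])
    show "norm (\<beta> (W (\<tau> + s * \<delta>) M) (g \<delta>)) \<le> C * B * norm (g \<delta>) * norm M" for \<tau> \<delta> M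
    proof -
      have "norm (\<beta> (W (\<tau> + s * \<delta>) M) (g \<delta>)) \<le> norm (W (\<tau> + s * \<delta>) M) * norm (g \<delta>) * C" by (rule C)
      also have "\<dots> \<le> (B * norm M) * norm (g \<delta>) * C"
        using C(1) B(2) by (intro mult_right_mono) auto
      finally show ?thesis by (simp add: mult_ac)
    qed
    show "integrable (lebesgue_on S) (\<lambda>\<delta>. C * B * norm (g \<delta>))" using g by auto
  qed (rule that)
qed

lemma kernel_operator_integral_inside:
  fixes \<beta> :: "'k::euclidean_space \<Rightarrow> 'g::euclidean_space \<Rightarrow> 'm::euclidean_space"
  assumes W: "kernel_operator W" and \<beta>: "bounded_bilinear \<beta>" and g: "integrable (lebesgue_on S) g"
  obtains V where "kernel_operator V"
    "\<And>\<tau> M. has_iint1 S (\<lambda>\<delta>. W (\<tau> + s * \<delta>) (\<beta> M (g \<delta>))) (V \<tau> M)"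
proof -
  obtain B where B: "B \<ge> 0" "\<And>\<tau> M. norm (W \<tau> M) \<le> B * norm M"
    using kernel_operator_bound[OF W] by blast
  obtain C where C: "C > 0" "\<And>a b. norm (\<beta> a b) \<le> norm a * norm b * C"
    using bounded_bilinear.pos_bounded[OF \<beta>] by blast
  have Wc: "isCont (\<lambda>\<tau>. W \<tau> M) \<tau>" and Wl: "linear (W \<tau>)" for M \<tau>
    using W by (auto simp: kernel_operator_def continuous_on_eq_continuous_at)
  show thesis
  proof (rule kernel_operator_integral[of "\<lambda>\<tau> \<delta> M. W (\<tau> + s * \<delta>) (\<beta> M (g \<delta>))" S "\<lambda>\<delta>. C * B * norm (g \<delta>)"])
    show "(\<lambda>\<delta>. W (\<tau> + s * \<delta>) (\<beta> M (g \<delta>))) \<in> borel_measurable (lebesgue_on S)" for \<tau> M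
      by (intro borel_measurable_bounded_bilinear[OF _ borel_measurable_integrable[OF g] \<beta>]
          kernel_operator_measurable[OF W] borel_imp_lebesgue_on borel_measurable_const) measurable
    show "AE \<delta> in lebesgue_on S. isCont (\<lambda>\<tau>. W (\<tau> + s * \<delta>) (\<beta> M (g \<delta>))) \<tau>" for \<tau> M
      by (intro AE_I2 isCont_o2[OF _ Wc] continuous_intros)
    show "linear (\<lambda>M. W (\<tau> + s * \<delta>) (\<beta> M (g \<delta>)))" for \<tau> \<delta>
      by (intro linearI) (simp_all add: linear_add[OF Wl] linear_scale[OF Wl]
          bounded_bilinear.add_left[OF \<beta>] bounded_bilinear.scaleR_left[OF \<beta>])
    show "norm (W (\<tau> + s * \<delta>) (\<beta> M (g \<delta>))) \<le> C * B * norm (g \<delta>) * norm M" for \<tau> \<delta> M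
    proof -
      have "norm (W (\<tau> + s * \<delta>) (\<beta> M (g \<delta>))) \<le> B * norm (\<beta> M (g \<delta>))" by (rule B)
      also have "\<dots> \<le> B * (norm M * norm (g \<delta>) * C)"
        using C(2) B(1) by (intro mult_left_mono) auto
      finally show ?thesis by (simp add: mult_ac)
    qed
    show "integrable (lebesgue_on S) (\<lambda>\<delta>. C * B * norm (g \<delta>))" using g by auto
  qed (rule that)
qed

section \<open>The delay Lyapunov matrix\<close>

text \<open>The integrand is dominated by a constant times exp(- \<sigma> t): one factor K decays, and the other is
  bounded. Since K jumps only at 0, for given \<tau> the integrand is continuous in \<tau> except at
  t = - \<tau>.\<close>

lemma delay_lyapunov_matrix_exists:
  fixes G K :: "real \<Rightarrow> real^'n^'n"
  assumes G: "integrable (lebesgue_on {-h..0}) G" and h: "h > 0"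
    and K: "fundamental_matrix h A0 A1 G K" and stable: "exponentially_stable h A0 A1 G"
  obtains U where "delay_lyapunov_matrix K U" "kernel_operator U"
proof -
  obtain g where g: "delay_kernel h G g" using delay_kernel_exists[OF G] .
  note VK = fundamental_matrix_imp_volterra[OF G g h K]
  note [measurable] = causal_boundedD(1)[OF VK(1)]
  obtain C \<sigma> where C: "C \<ge> 0" and \<sigma>: "\<sigma> > 0" and decay: "\<And>t. norm (K t) \<le> C * exp (- \<sigma> * t)"
    using fundamental_matrix_decay[OF G h K stable] by blast
  have KC: "norm (K t) \<le> C" for t
  proof (cases "t < 0")
    case True
    then show ?thesis using causal_boundedD(2)[OF VK(1)] C by simp
  next
    case False
    have "norm (K t) \<le> C * exp (- \<sigma> * t)" by (rule decay)
    also have "\<dots> \<le> C * 1" using False \<sigma> C by (intro mult_left_mono) auto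
    finally show ?thesis by simp
  qed
  obtain m where m: "m > 0" "\<And>(X :: real^'n^'n) (Y :: real^'n^'n). norm (X ** Y) \<le> m * (norm X * norm Y)"
    using matrix_mult_bound by metis
  obtain d where d: "d \<ge> 0" "\<And>X :: real^'n^'n. norm (transpose X) \<le> norm X * d"
    using bounded_linear.nonneg_bounded[OF bounded_linear_transpose] by blast
  define w where "w t = (m * m * d * C * C) * exp (- (\<sigma> * t))" for t :: real
  have K_cont: "isCont K t" if "t \<noteq> 0" for t
  proof (cases "t < 0")
    case True
    then have "eventually (\<lambda>y. y < 0) (nhds t)"
      by (intro order_tendstoD) (auto intro: tendsto_ident_at filterlim_ident)
    then have "eventually (\<lambda>y. K y = 0) (nhds t)"
      by eventually_elim (use causal_boundedD(2)[OF VK(1)] in auto)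
    then show ?thesis using isCont_cong[of K "\<lambda>_. 0" t] by simp
  next
    case False
    then have "t > 0" using that by simp
    have "continuous_on {0<..} K" by (rule continuous_on_subset[OF VK(2)]) auto
    then show ?thesis using \<open>t > 0\<close> by (simp add: continuous_on_eq_continuous_at)
  qed
  show thesis
  proof (rule kernel_operator_integral[of "\<lambda>\<tau> t M. transpose (K t) ** M ** K (t + \<tau>)" "{0..}" w])
    show "(\<lambda>t. transpose (K t) ** M ** K (t + \<tau>)) \<in> borel_measurable (lebesgue_on {0..})" for \<tau> M
      by (rule borel_imp_lebesgue_on) measurable
    show "AE t in lebesgue_on {0..}. isCont (\<lambda>\<tau>. transpose (K t) ** M ** K (t + \<tau>)) \<tau>" for \<tau> M
    proof -
      have "AE t in lebesgue. t \<noteq> - \<tau>" by (rule AE_completion[OF AE_lborel_singleton])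
      then have "AE t in lebesgue_on {0..}. t \<noteq> - \<tau>"
        by (subst AE_restrict_space_iff) (auto elim: eventually_mono)
      then show ?thesis
      proof eventually_elim
        case (elim t)
        then have "isCont (\<lambda>\<tau>. K (t + \<tau>)) \<tau>"
          by (intro isCont_o2[OF _ K_cont] continuous_intros) auto
        then show ?case by (intro mm.continuous continuous_const)
      qed
    qed
    show "linear (\<lambda>M. transpose (K t) ** M ** K (t + \<tau>))" for \<tau> t
      by (intro linearI) (simp_all add: mm.add_left mm.add_right mm.scaleR_left mm.scaleR_right)
    show "norm (transpose (K t) ** M ** K (t + \<tau>)) \<le> w t * norm M" for \<tau> t M
    proof -
      have "norm (transpose (K t) ** M ** K (t + \<tau>)) \<le> m * (norm (transpose (K t) ** M) * norm (K (t + \<tau>)))"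
        by (rule m)
      also have "\<dots> \<le> m * ((m * (norm (transpose (K t)) * norm M)) * C)"
        using m KC by (intro mult_left_mono mult_mono) auto
      also have "\<dots> \<le> m * ((m * ((C * exp (- (\<sigma> * t)) * d) * norm M)) * C)"
        using m(1) C order_trans[OF d(2)[of "K t"] mult_right_mono[OF decay d(1), of t]]
        by (intro mult_left_mono mult_right_mono) auto
      finally show ?thesis by (simp add: w_def mult_ac)
    qed
    have "integrable lborel (\<lambda>t. (m * m * d * C * C) * (indicator {0..} t * exp (- (\<sigma> * t))))"
      using integrable_exp_Ici[OF \<sigma>] by (intro integrable_mult_right) (simp add: has_bochner_integral_iff)
    moreover have "(m * m * d * C * C) * (indicator {0..} t * exp (- (\<sigma> * t))) = indicator {0..} t *\<^sub>R w t" for t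
      by (simp add: w_def)
    ultimately have "integrable lborel (\<lambda>t. indicator {0..} t *\<^sub>R w t)" by (simp only:)
    then have "integrable lebesgue (\<lambda>t. indicator {0..} t *\<^sub>R w t)"
      by (simp add: integrable_completion borel_measurable_integrable)
    then show "integrable (lebesgue_on {0..}) w"
      by (simp add: integrable_restrict_space)
  qed (rule that, simp_all add: delay_lyapunov_matrix_def has_iint1_def)
qed

section \<open>Iterated integrals\<close>

lemma has_iint1_unique: "has_iint1 S f I \<Longrightarrow> has_iint1 S f J \<Longrightarrow> I = J"
  unfolding has_iint1_def by (rule has_bochner_integral_eq)

lemma has_iint1_cong:
  assumes "\<And>x. x \<in> S \<Longrightarrow> f x = g x"
  shows "has_iint1 S f I \<longleftrightarrow> has_iint1 S g I"
  unfolding has_iint1_def by (rule has_bochner_integral_cong) (use assms in auto)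

lemma has_iint2I:
  "(\<And>x. x \<in> S \<Longrightarrow> has_iint1 T (f x) (g x)) \<Longrightarrow> has_iint1 S g I \<Longrightarrow> has_iint2 S T f I"
  unfolding has_iint2_def by blast

lemma has_iint3I:
  "(\<And>x. x \<in> S \<Longrightarrow> has_iint2 T V (f x) (g x)) \<Longrightarrow> has_iint1 S g I \<Longrightarrow> has_iint3 S T V f I"
  unfolding has_iint3_def by blast

lemma has_iint3_inner:
  assumes "\<And>x y. has_iint1 V (f x y) (g x y)" "has_iint2 S T g I"
  shows "has_iint3 S T V f I"
proof -
  obtain k where k: "\<And>x. x \<in> S \<Longrightarrow> has_iint1 T (g x) (k x)" "has_iint1 S k I"
    using assms(2) by (auto simp: has_iint2_def)
  show ?thesis by (rule has_iint3I[OF has_iint2I[OF assms(1) k(1)] k(2)])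
qed

lemma has_iint4_inner:
  assumes "\<And>x y. has_iint2 V W (f x y) (g x y)" "has_iint2 S T g I"
  shows "has_iint4 S T V W f I"
proof -
  obtain k where k: "\<And>x. x \<in> S \<Longrightarrow> has_iint1 T (g x) (k x)" "has_iint1 S k I"
    using assms(2) by (auto simp: has_iint2_def)
  have "\<forall>x\<in>S. has_iint3 T V W (f x) (k x)"
    by (intro ballI has_iint3I[OF assms(1) k(1)])
  with k(2) show ?thesis unfolding has_iint4_def by blast
qed

lemma has_iint2_unique: "has_iint2 S T f I \<Longrightarrow> has_iint2 S T f J \<Longrightarrow> I = J"
  unfolding has_iint2_def using has_iint1_unique has_iint1_cong by metis

lemma has_iint3_unique: "has_iint3 S T V f I \<Longrightarrow> has_iint3 S T V f J \<Longrightarrow> I = J"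
  unfolding has_iint3_def using has_iint2_unique has_iint1_unique has_iint1_cong by metis

lemma has_iint4_unique: "has_iint4 S T V W f I \<Longrightarrow> has_iint4 S T V W f J \<Longrightarrow> I = J"
  unfolding has_iint4_def using has_iint3_unique has_iint1_unique has_iint1_cong by metis

text \<open>Rewriting each integral to its unique value lets two representations of a long sum be compared by
  rewriting alone.\<close>

lemma has_iint_eq_The:
  "has_iint1 S f1 I1 \<Longrightarrow> (THE J. has_iint1 S f1 J) = I1"
  "has_iint2 S T f2 I2 \<Longrightarrow> (THE J. has_iint2 S T f2 J) = I2"
  "has_iint3 S T V f3 I3 \<Longrightarrow> (THE J. has_iint3 S T V f3 J) = I3"
  "has_iint4 S T V W f4 I4 \<Longrightarrow> (THE J. has_iint4 S T V W f4 J) = I4"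
  by (blast intro: the_equality has_iint1_unique has_iint2_unique has_iint3_unique has_iint4_unique)+

lemma has_Pi0_unique: "has_Pi0 h U M1 M2 M3 P \<Longrightarrow> has_Pi0 h U M1 M2 M3 P' \<Longrightarrow> P = P'"
  unfolding has_Pi0_def by (elim exE conjE, (drule has_iint_eq_The)+, simp only:)

lemma has_Pi1_unique:
  "has_Pi1 h A1 G U M1 M2 M3 \<theta> P \<Longrightarrow> has_Pi1 h A1 G U M1 M2 M3 \<theta> P' \<Longrightarrow> P = P'"
  unfolding has_Pi1_def by (elim exE conjE, (drule has_iint_eq_The)+, simp only:)

lemma has_Pi2_unique:
  "has_Pi2 h A1 G U M1 M2 M3 \<xi> \<theta> P \<Longrightarrow> has_Pi2 h A1 G U M1 M2 M3 \<xi> \<theta> P' \<Longrightarrow> P = P'"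
  unfolding has_Pi2_def by (elim exE conjE, (drule has_iint_eq_The)+, simp only:)

lemma delay_lyapunov_matrix_unique:
  "delay_lyapunov_matrix K U \<Longrightarrow> delay_lyapunov_matrix K U' \<Longrightarrow> U = U'"
  unfolding delay_lyapunov_matrix_def by (intro ext) (blast intro: has_bochner_integral_eq)

lemma has_iint1_bounded_linear:
  assumes "bounded_linear L" "has_iint1 S f I"
  shows "has_iint1 S (\<lambda>x. L (f x)) (L I)"
  using assms unfolding has_iint1_def by (rule has_bochner_integral_bounded_linear)

text \<open>Integration inside the argument, with the scalars as the space of matrix arguments and scalar
  multiplication as the product, evaluated at the scalar 1.\<close>

lemma has_iint1_kernel_operator:
  assumes W: "kernel_operator W" and X: "integrable (lebesgue_on S) X"
  obtains I where "has_iint1 S (\<lambda>\<delta>. W (\<tau> + s * \<delta>) (X \<delta>)) I"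
proof -
  obtain V where "kernel_operator V"
    and V: "\<And>\<tau> M. has_iint1 S (\<lambda>\<delta>. W (\<tau> + s * \<delta>) (M *\<^sub>R X \<delta>)) (V \<tau> M)"
    by (rule kernel_operator_integral_inside[OF W bounded_bilinear_scaleR X, of s]) (rule that, simp_all)
  from V[of \<tau> 1] show thesis using that by simp
qed

section \<open>Existence of the matrices\<close>

text \<open>With the arguments in this order the weight comes second, so that weights multiplied from the left fit the
  rules for integrals of kernel operators.\<close>

lemma bounded_bilinear_transpose_mult:
  "bounded_bilinear (\<lambda>(X :: real^'p^'m) (Y :: real^'n^'m). transpose Y ** X)"
  using bounded_bilinear.flip[OF bounded_bilinear.comp[OF bounded_bilinear_matrix_mult
        bounded_linear_transpose bounded_linear_ident]] .

text \<open>The weight transpose (\<Gamma> \<theta>1) ** R ** \<Gamma> \<theta>2 is a product of functions of one variable. The inner integral over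
  \<theta>1 is again a kernel operator, now applied to the rectangular matrix R ** \<Gamma> \<theta>2.\<close>

lemma has_iint2_kernel_operator:
  fixes W :: "real \<Rightarrow> real^'n^'n \<Rightarrow> 'v::euclidean_space" and \<Gamma> :: "real \<Rightarrow> real^'n^'r"
  assumes W: "kernel_operator W" and \<Gamma>: "integrable (lebesgue_on S) \<Gamma>"
  obtains I where "has_iint2 S S (\<lambda>\<theta>2 \<theta>1. W (\<tau> + \<theta>2 - \<theta>1) (transpose (\<Gamma> \<theta>1) ** R ** \<Gamma> \<theta>2)) I"
proof -
  obtain V where V: "kernel_operator V"
    "\<And>\<tau> Y. has_iint1 S (\<lambda>\<theta>1. W (\<tau> + (-1) * \<theta>1) (transpose (\<Gamma> \<theta>1) ** (Y :: real^'n^'r))) (V \<tau> Y)"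
    by (rule kernel_operator_integral_inside[OF W bounded_bilinear_transpose_mult \<Gamma>, of "-1"]) (rule that, simp_all)
  have R\<Gamma>: "integrable (lebesgue_on S) (\<lambda>\<theta>. R ** \<Gamma> \<theta>)"
    by (rule integrable_bounded_linear[OF mm.bounded_linear_right \<Gamma>])
  obtain I where I: "has_iint1 S (\<lambda>\<theta>2. V (\<tau> + 1 * \<theta>2) (R ** \<Gamma> \<theta>2)) I"
    by (rule has_iint1_kernel_operator[OF V(1) R\<Gamma>])
  have "has_iint1 S (\<lambda>\<theta>1. W (\<tau> + \<theta>2 - \<theta>1) (transpose (\<Gamma> \<theta>1) ** R ** \<Gamma> \<theta>2)) (V (\<tau> + 1 * \<theta>2) (R ** \<Gamma> \<theta>2))" for \<theta>2
    using V(2)[of "\<tau> + \<theta>2" "R ** \<Gamma> \<theta>2"] by (simp add: matrix_mul_assoc)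
  from has_iint2I[OF this I] show thesis by (rule that)
qed

lemma kernel_operator_integral_right:
  fixes W :: "real \<Rightarrow> 'm::euclidean_space \<Rightarrow> real^'n^'n" and G :: "real \<Rightarrow> real^'n^'n"
  assumes W: "kernel_operator W" and G: "integrable (lebesgue_on S) G"
  obtains V where "kernel_operator V" "\<And>\<tau> M. has_iint1 S (\<lambda>\<delta>. W (\<tau> + \<delta>) M ** G \<delta>) (V \<tau> M)"
proof -
  obtain V where V: "kernel_operator V"
    "\<And>\<tau> M. has_iint1 S (\<lambda>\<delta>. W (\<tau> + 1 * \<delta>) M ** G \<delta>) (V \<tau> M)"
    by (rule kernel_operator_integral_outside[OF W bounded_bilinear_matrix_mult G, of 1]) (rule that, simp_all)
  then show thesis by (intro that[OF V(1)]) simp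
qed

lemma kernel_operator_integral_left:
  fixes W :: "real \<Rightarrow> 'm::euclidean_space \<Rightarrow> real^'n^'n" and G :: "real \<Rightarrow> real^'n^'n"
  assumes W: "kernel_operator W" and G: "integrable (lebesgue_on S) G"
  obtains V where "kernel_operator V" "\<And>\<tau> M. has_iint1 S (\<lambda>\<delta>. transpose (G \<delta>) ** W (\<tau> - \<delta>) M) (V \<tau> M)"
proof -
  obtain V where V: "kernel_operator V"
    "\<And>\<tau> M. has_iint1 S (\<lambda>\<delta>. transpose (G \<delta>) ** W (\<tau> + (-1) * \<delta>) M) (V \<tau> M)"
    by (rule kernel_operator_integral_outside[OF W bounded_bilinear_transpose_mult G, of "-1"]) (rule that, simp_all)
  then show thesis by (intro that[OF V(1)]) simp
qed

lemma kernel_operator_integral_both: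
  fixes W :: "real \<Rightarrow> 'm::euclidean_space \<Rightarrow> real^'n^'n" and G :: "real \<Rightarrow> real^'n^'n"
  assumes W: "kernel_operator W" and G: "integrable (lebesgue_on S) G" "integrable (lebesgue_on T) G"
  obtains V where "kernel_operator V"
    "\<And>\<tau> M. has_iint2 S T (\<lambda>\<delta>1 \<delta>2. transpose (G \<delta>1) ** W (\<tau> - \<delta>1 + \<delta>2) M ** G \<delta>2) (V \<tau> M)"
proof -
  obtain VR where VR: "kernel_operator VR"
    "\<And>\<tau> M. has_iint1 T (\<lambda>\<delta>. W (\<tau> + \<delta>) M ** G \<delta>) (VR \<tau> M)"
    by (rule kernel_operator_integral_right[OF W G(2)]) (rule that, simp_all)
  obtain V where V: "kernel_operator V"
    "\<And>\<tau> M. has_iint1 S (\<lambda>\<delta>. transpose (G \<delta>) ** VR (\<tau> - \<delta>) M) (V \<tau> M)"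
    by (rule kernel_operator_integral_left[OF VR(1) G(1)]) (rule that, simp_all)
  have *: "has_iint1 T (\<lambda>\<delta>2. transpose (G \<delta>1) ** W (\<tau> - \<delta>1 + \<delta>2) M ** G \<delta>2) (transpose (G \<delta>1) ** VR (\<tau> - \<delta>1) M)"
    for \<tau> M \<delta>1
    using has_iint1_bounded_linear[OF mm.bounded_linear_right VR(2)] by (simp add: matrix_mul_assoc)
  show thesis by (rule that[OF V(1)]) (rule has_iint2I[OF * V(2)])
qed

lemma has_Pi0_exists:
  fixes U :: "real \<Rightarrow> real^'n^'n \<Rightarrow> real^'n^'n" and \<Gamma> :: "real \<Rightarrow> real^'n^'r"
  assumes U: "kernel_operator U" and M2: "integrable (lebesgue_on {-h..0}) M2"
    and \<Gamma>: "integrable (lebesgue_on {-h..0}) \<Gamma>" and M3: "\<And>\<theta>1 \<theta>2. M3 \<theta>1 \<theta>2 = transpose (\<Gamma> \<theta>1) ** R ** \<Gamma> \<theta>2"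
  shows "\<exists>P. has_Pi0 h U M1 M2 M3 P"
proof -
  obtain I1 where "has_iint1 {-h..0} (\<lambda>\<theta>. U \<theta> (M2 \<theta>)) I1"
    using has_iint1_kernel_operator[OF U M2, of 0 1] by auto
  moreover obtain I2 where "has_iint2 {-h..0} {-h..0} (\<lambda>\<theta>2 \<theta>1. U (- \<theta>1 + \<theta>2) (M3 \<theta>1 \<theta>2)) I2"
    using has_iint2_kernel_operator[OF U \<Gamma>, of 0 R] by (auto simp: M3)
  ultimately show ?thesis unfolding has_Pi0_def by blast
qed

lemma integrable_initial_segment:
  assumes "integrable (lebesgue_on {-h..0}) G" "\<theta> \<le> 0"
  shows "integrable (lebesgue_on {-h..\<theta>}) (G :: real \<Rightarrow> real^'n^'n)"
proof -
  have "set_integrable lebesgue {-h..0} G"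
    using assms(1) by (simp add: set_integrable_def integrable_restrict_space)
  then have "set_integrable lebesgue {-h..\<theta>} G"
    by (rule set_integrable_subset) (use assms(2) in auto)
  then show ?thesis by (simp add: set_integrable_def integrable_restrict_space)
qed

lemma has_Pi1_exists:
  fixes U :: "real \<Rightarrow> real^'n^'n \<Rightarrow> real^'n^'n" and \<Gamma> :: "real \<Rightarrow> real^'n^'r"
  assumes U: "kernel_operator U" and M2: "integrable (lebesgue_on {-h..0}) M2"
    and \<Gamma>: "integrable (lebesgue_on {-h..0}) \<Gamma>" and M3: "\<And>\<theta>1 \<theta>2. M3 \<theta>1 \<theta>2 = transpose (\<Gamma> \<theta>1) ** R ** \<Gamma> \<theta>2"
    and G: "integrable (lebesgue_on {-h..0}) G" and \<theta>: "\<theta> \<le> 0"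
  shows "\<exists>P. has_Pi1 h A1 G U M1 M2 M3 \<theta> P"
proof -
  note M2T = integrable_transpose[OF M2]
  obtain VR where VR: "kernel_operator VR"
    "\<And>\<tau> M. has_iint1 {-h..\<theta>} (\<lambda>\<delta>. U (\<tau> + \<delta>) M ** G \<delta>) (VR \<tau> M)"
    by (rule kernel_operator_integral_right[OF U integrable_initial_segment[OF G \<theta>]]) (rule that, simp_all)
  obtain I2 where 2: "has_iint1 {-h..0} (\<lambda>\<theta>2. U (\<theta>2 - \<theta> - h) (M2 \<theta>2)) I2"
    using has_iint1_kernel_operator[OF U M2, of "- \<theta> - h" 1] by (auto simp: algebra_simps)
  obtain I3 where 3: "has_iint1 {-h..0} (\<lambda>\<theta>2. U (- \<theta>2 - \<theta> - h) (transpose (M2 \<theta>2))) I3"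
    using has_iint1_kernel_operator[OF U M2T, of "- \<theta> - h" "-1"] by (auto simp: algebra_simps)
  obtain I4 where "has_iint1 {-h..0} (\<lambda>\<theta>2. VR (\<theta>2 - \<theta>) (M2 \<theta>2)) I4"
    using has_iint1_kernel_operator[OF VR(1) M2, of "- \<theta>" 1] by auto
  then have 4: "has_iint2 {-h..0} {-h..\<theta>} (\<lambda>\<theta>2 \<delta>. U (\<theta>2 - \<theta> + \<delta>) (M2 \<theta>2) ** G \<delta>) I4"
    by (rule has_iint2I[OF VR(2)])
  obtain I5 where "has_iint1 {-h..0} (\<lambda>\<theta>2. VR (- \<theta>2 - \<theta>) (transpose (M2 \<theta>2))) I5"
    using has_iint1_kernel_operator[OF VR(1) M2T, of "- \<theta>" "-1"] by (auto simp: algebra_simps)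
  then have 5: "has_iint2 {-h..0} {-h..\<theta>} (\<lambda>\<theta>2 \<delta>. U (- \<theta>2 - \<theta> + \<delta>) (transpose (M2 \<theta>2)) ** G \<delta>) I5"
    by (rule has_iint2I[OF VR(2)])
  obtain I6 where 6: "has_iint2 {-h..0} {-h..0} (\<lambda>\<theta>2 \<theta>1. U (- \<theta>1 + \<theta>2 - \<theta> - h) (M3 \<theta>1 \<theta>2)) I6"
    using has_iint2_kernel_operator[OF U \<Gamma>, of "- \<theta> - h" R] by (auto simp: M3 algebra_simps)
  obtain I7 where "has_iint2 {-h..0} {-h..0} (\<lambda>\<theta>2 \<theta>1. VR (- \<theta>1 + \<theta>2 - \<theta>) (M3 \<theta>1 \<theta>2)) I7"
    using has_iint2_kernel_operator[OF VR(1) \<Gamma>, of "- \<theta>" R] by (auto simp: M3 algebra_simps)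
  then have 7: "has_iint3 {-h..0} {-h..0} {-h..\<theta>}
      (\<lambda>\<theta>2 \<theta>1 \<delta>. U (- \<theta>1 + \<theta>2 - \<theta> + \<delta>) (M3 \<theta>1 \<theta>2) ** G \<delta>) I7"
    by (rule has_iint3_inner[OF VR(2)])
  show ?thesis
    unfolding has_Pi1_def by (intro exI conjI) (rule VR(2) 2 3 4 5 6 7 refl)+
qed

text \<open>The twelve terms arise from the four kernel operators U, VR, VL and VB, which integrate G over neither side, the
  right, the left, or both sides of U. Each of them is evaluated at M1, integrated once against M2, and
  integrated twice against M3.\<close>

lemma has_Pi2_exists:
  fixes U :: "real \<Rightarrow> real^'n^'n \<Rightarrow> real^'n^'n" and \<Gamma> :: "real \<Rightarrow> real^'n^'r"
  assumes U: "kernel_operator U" and M2: "integrable (lebesgue_on {-h..0}) M2"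
    and \<Gamma>: "integrable (lebesgue_on {-h..0}) \<Gamma>" and M3: "\<And>\<theta>1 \<theta>2. M3 \<theta>1 \<theta>2 = transpose (\<Gamma> \<theta>1) ** R ** \<Gamma> \<theta>2"
    and G: "integrable (lebesgue_on {-h..0}) G" and \<xi>: "\<xi> \<le> 0" and \<theta>: "\<theta> \<le> 0"
  shows "\<exists>P. has_Pi2 h A1 G U M1 M2 M3 \<xi> \<theta> P"
proof -
  note G\<theta> = integrable_initial_segment[OF G \<theta>] and G\<xi> = integrable_initial_segment[OF G \<xi>]
  obtain VR where VR: "kernel_operator VR"
    "\<And>\<tau> M. has_iint1 {-h..\<theta>} (\<lambda>\<delta>. U (\<tau> + \<delta>) M ** G \<delta>) (VR \<tau> M)"
    by (rule kernel_operator_integral_right[OF U G\<theta>]) (rule that, simp_all)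
  obtain VL where VL: "kernel_operator VL"
    "\<And>\<tau> M. has_iint1 {-h..\<xi>} (\<lambda>\<delta>. transpose (G \<delta>) ** U (\<tau> - \<delta>) M) (VL \<tau> M)"
    by (rule kernel_operator_integral_left[OF U G\<xi>]) (rule that, simp_all)
  obtain VB where VB: "kernel_operator VB"
    "\<And>\<tau> M. has_iint2 {-h..\<xi>} {-h..\<theta>} (\<lambda>\<delta>1 \<delta>2. transpose (G \<delta>1) ** U (\<tau> - \<delta>1 + \<delta>2) M ** G \<delta>2) (VB \<tau> M)"
    by (rule kernel_operator_integral_both[OF U G\<xi> G\<theta>]) (rule that, simp_all)
  have L: "has_iint1 {-h..\<xi>} (\<lambda>\<delta>. transpose (G \<delta>) ** U (a \<delta>) M) (VL \<tau> M)"
    if "\<And>\<delta>. a \<delta> = \<tau> - \<delta>" for a \<tau> M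
    using VL(2) by (simp add: that)
  have B: "has_iint2 {-h..\<xi>} {-h..\<theta>} (\<lambda>\<delta>1 \<delta>2. transpose (G \<delta>1) ** U (a \<delta>1 \<delta>2) M ** G \<delta>2) (VB \<tau> M)"
    if "\<And>\<delta>1 \<delta>2. a \<delta>1 \<delta>2 = \<tau> - \<delta>1 + \<delta>2" for a \<tau> M
    using VB(2) by (simp add: that)
  have 2: "has_iint1 {-h..\<xi>} (\<lambda>\<delta>. transpose (G \<delta>) ** U (\<xi> - \<delta> - \<theta> - h) M1 ** A1) (VL (\<xi> - \<theta> - h) M1 ** A1)"
    by (intro has_iint1_bounded_linear[OF mm.bounded_linear_left] L) simp
  obtain I4 where 4: "has_iint1 {-h..0} (\<lambda>\<theta>2. U (\<xi> + \<theta>2 - \<theta>) (M2 \<theta>2)) I4"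
    using has_iint1_kernel_operator[OF U M2, of "\<xi> - \<theta>" 1] by (auto simp: algebra_simps)
  obtain I5 where "has_iint1 {-h..0} (\<lambda>\<theta>2. VR (\<xi> + h + \<theta>2 - \<theta>) (M2 \<theta>2)) I5"
    using has_iint1_kernel_operator[OF VR(1) M2, of "\<xi> + h - \<theta>" 1] by (auto simp: algebra_simps)
  then have 5: "has_iint2 {-h..0} {-h..\<theta>} (\<lambda>\<theta>2 \<delta>. U (\<xi> + h + \<theta>2 - \<theta> + \<delta>) (M2 \<theta>2) ** G \<delta>) I5"
    by (rule has_iint2I[OF VR(2)])
  obtain I6 where I6: "has_iint1 {-h..0} (\<lambda>\<theta>2. VL (\<xi> - \<theta> - h + 1 * \<theta>2) (M2 \<theta>2)) I6"
    using has_iint1_kernel_operator[OF VL(1) M2] .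
  have 6: "has_iint2 {-h..0} {-h..\<xi>} (\<lambda>\<theta>2 \<delta>. transpose (G \<delta>) ** U (\<xi> - \<delta> + \<theta>2 - \<theta> - h) (M2 \<theta>2)) I6"
    by (rule has_iint2I[OF L I6]) simp
  obtain I7 where I7: "has_iint1 {-h..0} (\<lambda>\<theta>2. VB (\<xi> - \<theta> + 1 * \<theta>2) (M2 \<theta>2)) I7"
    using has_iint1_kernel_operator[OF VB(1) M2] .
  have 7: "has_iint3 {-h..0} {-h..\<xi>} {-h..\<theta>}
      (\<lambda>\<theta>2 \<delta>1 \<delta>2. transpose (G \<delta>1) ** U (\<xi> - \<delta>1 + \<theta>2 - \<theta> + \<delta>2) (M2 \<theta>2) ** G \<delta>2) I7"
    by (rule has_iint3I[OF B I7]) simp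
  obtain I8 where 8: "has_iint2 {-h..0} {-h..0} (\<lambda>\<theta>2 \<theta>1. U (- \<theta>1 + \<xi> + \<theta>2 - \<theta>) (M3 \<theta>1 \<theta>2)) I8"
    using has_iint2_kernel_operator[OF U \<Gamma>, of "\<xi> - \<theta>" R] by (auto simp: M3 algebra_simps)
  obtain I9 where "has_iint2 {-h..0} {-h..0} (\<lambda>\<theta>2 \<theta>1. VR (- \<theta>1 + \<xi> + h + \<theta>2 - \<theta>) (M3 \<theta>1 \<theta>2)) I9"
    using has_iint2_kernel_operator[OF VR(1) \<Gamma>, of "\<xi> + h - \<theta>" R] by (auto simp: M3 algebra_simps)
  then have 9: "has_iint3 {-h..0} {-h..0} {-h..\<theta>}
      (\<lambda>\<theta>2 \<theta>1 \<delta>. U (- \<theta>1 + \<xi> + h + \<theta>2 - \<theta> + \<delta>) (M3 \<theta>1 \<theta>2) ** G \<delta>) I9"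
    by (rule has_iint3_inner[OF VR(2)])
  obtain I10 where I10: "has_iint2 {-h..0} {-h..0} (\<lambda>\<theta>2 \<theta>1. VL (\<xi> - \<theta> - h + \<theta>2 - \<theta>1) (M3 \<theta>1 \<theta>2)) I10"
    using has_iint2_kernel_operator[OF VL(1) \<Gamma>, of "\<xi> - \<theta> - h" R] by (auto simp: M3)
  have 10: "has_iint3 {-h..0} {-h..0} {-h..\<xi>}
      (\<lambda>\<theta>2 \<theta>1 \<delta>. transpose (G \<delta>) ** U (- \<theta>1 + \<xi> - \<delta> + \<theta>2 - \<theta> - h) (M3 \<theta>1 \<theta>2)) I10"
    by (rule has_iint3_inner[OF L I10]) simp
  obtain I11 where I11: "has_iint2 {-h..0} {-h..0} (\<lambda>\<theta>2 \<theta>1. VB (\<xi> - \<theta> + \<theta>2 - \<theta>1) (M3 \<theta>1 \<theta>2)) I11"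
    using has_iint2_kernel_operator[OF VB(1) \<Gamma>, of "\<xi> - \<theta>" R] by (auto simp: M3)
  have 11: "has_iint4 {-h..0} {-h..0} {-h..\<xi>} {-h..\<theta>}
      (\<lambda>\<theta>2 \<theta>1 \<delta>1 \<delta>2. transpose (G \<delta>1)
         ** U (- \<theta>1 + \<xi> - \<delta>1 + \<theta>2 - \<theta> + \<delta>2) (M3 \<theta>1 \<theta>2) ** G \<delta>2) I11"
    by (rule has_iint4_inner[OF B I11]) simp
  have 3: "has_iint2 {-h..\<xi>} {-h..\<theta>}
      (\<lambda>\<delta>1 \<delta>2. transpose (G \<delta>1) ** U (\<xi> - \<theta> - \<delta>1 + \<delta>2) M1 ** G \<delta>2) (VB (\<xi> - \<theta>) M1)"
    by (rule B) simp
  show ?thesis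
    unfolding has_Pi2_def by (intro exI conjI) (rule VR(2) 2 3 4 5 6 7 8 9 10 11 refl)+
qed

theorem corollary1:
  fixes h :: real
    and A B Q A0 A1 M1 :: "real^'n^'n"
    and D :: "real^'r^'n"
    and R :: "real^'r^'r"
    and E G M2 :: "real \<Rightarrow> real^'n^'n"
    and M3 :: "real \<Rightarrow> real \<Rightarrow> real^'n^'n"
    and \<Gamma>0 :: "real^'n^'r"
    and \<Gamma>1 :: "real \<Rightarrow> real^'n^'r"
  assumes "h > 0"
    and "continuous_on {-h..0} E"
    and "integrable (lebesgue_on {-h..0}) \<Gamma>1"
    and "sym_pos_def Q" and "sym_pos_def R"
    and "A0 = A + D ** \<Gamma>0"
    and "A1 = B"
    and "G = (\<lambda>\<theta>. E \<theta> + D ** \<Gamma>1 \<theta>)"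
    and "exponentially_stable h A0 A1 G"
    and "M1 = Q + transpose \<Gamma>0 ** R ** \<Gamma>0"
    and "M2 = (\<lambda>\<theta>. transpose \<Gamma>0 ** R ** \<Gamma>1 \<theta>)"
    and "M3 = (\<lambda>\<theta>1 \<theta>2. transpose (\<Gamma>1 \<theta>1) ** R ** \<Gamma>1 \<theta>2)"
  shows "\<exists>P0 P1 P2. Pi_system h A0 A1 G M1 M2 M3 P0 P1 P2 \<and>
           (\<forall>P0' P1' P2'. Pi_system h A0 A1 G M1 M2 M3 P0' P1' P2' \<longrightarrow>
              P0' = P0 \<and>
              (\<forall>\<theta>\<in>{-h..0}. P1' \<theta> = P1 \<theta>) \<and>
              (\<forall>\<xi>\<in>{-h..0}. \<forall>\<theta>\<in>{-h..0}. P2' \<xi> \<theta> = P2 \<xi> \<theta>))"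
proof -
  note h = assms(1) and \<Gamma> = assms(3)
  have G: "integrable (lebesgue_on {-h..0}) G"
    unfolding assms(8)
    by (intro Bochner_Integration.integrable_add continuous_imp_integrable_real assms(2)
        integrable_bounded_linear[OF mm.bounded_linear_right \<Gamma>])
  have M2: "integrable (lebesgue_on {-h..0}) M2"
    unfolding assms(11) by (rule integrable_bounded_linear[OF mm.bounded_linear_right \<Gamma>])
  have M3: "M3 \<theta>1 \<theta>2 = transpose (\<Gamma>1 \<theta>1) ** R ** \<Gamma>1 \<theta>2" for \<theta>1 \<theta>2
    by (simp add: assms(12))
  obtain K where K: "fundamental_matrix h A0 A1 G K"
    using fundamental_matrix_exists[OF G h] .
  obtain U where U: "delay_lyapunov_matrix K U" "kernel_operator U"
    using delay_lyapunov_matrix_exists[OF G h K assms(9)] .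
  obtain P0 where P0: "has_Pi0 h U M1 M2 M3 P0"
    using has_Pi0_exists[OF U(2) M2 \<Gamma> M3] by blast
  define P1 where "P1 \<theta> = (SOME P. has_Pi1 h A1 G U M1 M2 M3 \<theta> P)" for \<theta>
  have P1: "\<forall>\<theta>\<in>{-h..0}. has_Pi1 h A1 G U M1 M2 M3 \<theta> (P1 \<theta>)"
    unfolding P1_def by (intro ballI someI_ex[OF has_Pi1_exists[OF U(2) M2 \<Gamma> M3 G]]) simp
  define P2 where "P2 \<xi> \<theta> = (SOME P. has_Pi2 h A1 G U M1 M2 M3 \<xi> \<theta> P)" for \<xi> \<theta>
  have P2: "\<forall>\<xi>\<in>{-h..0}. \<forall>\<theta>\<in>{-h..0}. has_Pi2 h A1 G U M1 M2 M3 \<xi> \<theta> (P2 \<xi> \<theta>)"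
    unfolding P2_def by (intro ballI someI_ex[OF has_Pi2_exists[OF U(2) M2 \<Gamma> M3 G]]) simp_all
  have "P0' = P0 \<and> (\<forall>\<theta>\<in>{-h..0}. P1' \<theta> = P1 \<theta>) \<and> (\<forall>\<xi>\<in>{-h..0}. \<forall>\<theta>\<in>{-h..0}. P2' \<xi> \<theta> = P2 \<xi> \<theta>)"
    if P': "Pi_system h A0 A1 G M1 M2 M3 P0' P1' P2'" for P0' P1' P2'
  proof -
    obtain K' U' where K': "fundamental_matrix h A0 A1 G K'" and U': "delay_lyapunov_matrix K' U'"
      and P: "has_Pi0 h U' M1 M2 M3 P0'"
        "\<forall>\<theta>\<in>{-h..0}. has_Pi1 h A1 G U' M1 M2 M3 \<theta> (P1' \<theta>)"
        "\<forall>\<xi>\<in>{-h..0}. \<forall>\<theta>\<in>{-h..0}. has_Pi2 h A1 G U' M1 M2 M3 \<xi> \<theta> (P2' \<xi> \<theta>)"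
      using P' unfolding Pi_system_def by blast
    have "K' = K" by (rule fundamental_matrix_unique[OF G h K' K])
    then have "delay_lyapunov_matrix K U'" using U' by simp
    then have "U' = U" by (rule delay_lyapunov_matrix_unique[OF _ U(1)])
    note P = P[unfolded this]
    show ?thesis
    proof (intro conjI ballI)
      show "P0' = P0" by (rule has_Pi0_unique[OF P(1) P0])
      show "P1' \<theta> = P1 \<theta>" if "\<theta> \<in> {-h..0}" for \<theta>
        by (rule has_Pi1_unique[OF P(2)[rule_format, OF that] P1[rule_format, OF that]])
      show "P2' \<xi> \<theta> = P2 \<xi> \<theta>" if "\<xi> \<in> {-h..0}" "\<theta> \<in> {-h..0}" for \<xi> \<theta>
        by (rule has_Pi2_unique[OF P(3)[rule_format, OF that] P2[rule_format, OF that]])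
    qed
  qed
  moreover have "Pi_system h A0 A1 G M1 M2 M3 P0 P1 P2"
    unfolding Pi_system_def using K U(1) P0 P1 P2 by blast
  ultimately show ?thesis by blast
qed

end
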